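(* Let $T>0$ and let $(\Omega,(\mathcal{F}_t)_{t\in[0,T]},P)$ be a filtered probability space satisfying the usual conditions, with $\mathcal{F}_0$ trivial and $\mathcal{F}=\mathcal{F}_T$. Let $n\ge 1$, $\delta\in(0,1)$ and \[ \mathcal{O}=\Big\{x\in(0,\infty)^n:\ \max_{j}\frac{x_j}{x_1+\cdots+x_n}<1-\delta\Big\}. \] Let $S=(S(t))_{t\in[0,T]}$ be a continuous adapted process taking values in $\mathcal{O}$ which has conditional full support in $\mathcal{O}$. Then for every $\varepsilon>0$ there exists an $\varepsilon$-consistent price system $(\tilde S,Q)$ to $S$ such that $\tilde S$ takes values in $\mathcal{O}$.
   Context: Conditional full support: for an open set $\mathcal{O}\subset\mathbb{R}^n$ and a continuous adapted $\mathcal{O}$-valued process $(S(t))_{t\in[0,T]}$, we say $S$ has conditional full support in $\mathcal{O}$ if for all $t\in[0,T]$ and every open set $G\subset C([0,T],\mathcal{O})$ (topology of uniform convergence), $P(S\in G\mid\mathcal{F}_t)>0$ almost surely on the event $\{S|_{[0,t]}\in\{g|_{[0,t]}: g\in G\}\}$. An $\varepsilon$-consistent price system to $S$ is a pair $(\tilde S,Q)$ where $Q$ is a probability measure equivalent to $P$ and $\tilde S$ is a $Q$-martingale in the filtration $(\mathcal{F}_t)$ (not required to be continuous) such that $\frac{1}{1+\varepsilon}\le \tilde S_i(t)/S_i(t)\le 1+\varepsilon$ almost surely for all $t\in[0,T]$ and $i=1,\dots,n$. *)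

theory Defs
  imports "HOL-Probability.Probability"
begin

definition O_set :: "real \<Rightarrow> (real ^ 'n::finite) set" where
  "O_set \<delta> = {x. (\<forall>j. 0 < x $ j) \<and>
       Max (range (\<lambda>j. x $ j / (\<Sum>i\<in>UNIV. x $ i))) < 1 - \<delta>}"

definition usual_filtered_space :: "'a measure \<Rightarrow> (real \<Rightarrow> 'a measure) \<Rightarrow> real \<Rightarrow> bool" where
  "usual_filtered_space M F T \<longleftrightarrow>
     prob_space M \<and>
     (\<forall>t\<in>{0..T}. subalgebra M (F t)) \<and>
     (\<forall>s t. 0 \<le> s \<and> s \<le> t \<and> t \<le> T \<longrightarrow> sets (F s) \<subseteq> sets (F t)) \<and>
     \<comment> \<open>completeness: F_0 contains all subsets of P-null sets\<close>
     (\<forall>N. N \<subseteq> space M \<and> (\<exists>A\<in>sets M. N \<subseteq> A \<and> emeasure M A = 0) \<longrightarrow> N \<in> sets (F 0)) \<and>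
     \<comment> \<open>right continuity\<close>
     (\<forall>t\<in>{0..<T}. sets (F t) = (\<Inter>s\<in>{t<..T}. sets (F s))) \<and>
     \<comment> \<open>F_0 trivial\<close>
     (\<forall>A\<in>sets (F 0). measure M A = 0 \<or> measure M A = 1) \<and>
     \<comment> \<open>F = F_T\<close>
     sets M = sets (F T)"

text \<open>Open subsets of C([0,T],O) with the topology of uniform convergence.
  A path is represented by a function real => real^'n of which only the
  restriction to [0,T] matters.\<close>
definition path_space :: "real \<Rightarrow> (real ^ 'n::finite) set \<Rightarrow> (real \<Rightarrow> real ^ 'n) set" where
  "path_space T Ob = {g. continuous_on {0..T} g \<and> (\<forall>t\<in>{0..T}. g t \<in> Ob)}"

definition uniform_open :: "real \<Rightarrow> (real ^ 'n::finite) set \<Rightarrow> (real \<Rightarrow> real ^ 'n) set \<Rightarrow> bool" where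
  "uniform_open T Ob G \<longleftrightarrow> G \<subseteq> path_space T Ob \<and>
     (\<forall>g\<in>G. \<exists>e>0. \<forall>h\<in>path_space T Ob.
        (\<forall>t\<in>{0..T}. dist (h t) (g t) < e) \<longrightarrow> (\<exists>g'\<in>G. \<forall>t\<in>{0..T}. g' t = h t))"

definition path_event :: "'a measure \<Rightarrow> real \<Rightarrow> (real \<Rightarrow> 'a \<Rightarrow> real ^ 'n::finite) \<Rightarrow> (real \<Rightarrow> real ^ 'n) set \<Rightarrow> 'a set" where
  "path_event M T S G = {\<omega>\<in>space M. \<exists>g\<in>G. \<forall>t\<in>{0..T}. g t = S t \<omega>}"

definition cont_adapted_process :: "'a measure \<Rightarrow> (real \<Rightarrow> 'a measure) \<Rightarrow> real \<Rightarrow> (real ^ 'n::finite) set \<Rightarrow> (real \<Rightarrow> 'a \<Rightarrow> real ^ 'n) \<Rightarrow> bool" where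
  "cont_adapted_process M F T Ob S \<longleftrightarrow>
     (\<forall>t\<in>{0..T}. S t \<in> borel_measurable (F t)) \<and>
     (\<forall>\<omega>\<in>space M. continuous_on {0..T} (\<lambda>t. S t \<omega>)) \<and>
     (\<forall>t\<in>{0..T}. \<forall>\<omega>\<in>space M. S t \<omega> \<in> Ob)"

definition cond_full_support :: "'a measure \<Rightarrow> (real \<Rightarrow> 'a measure) \<Rightarrow> real \<Rightarrow> (real ^ 'n::finite) set \<Rightarrow> (real \<Rightarrow> 'a \<Rightarrow> real ^ 'n) \<Rightarrow> bool" where
  "cond_full_support M F T Ob S \<longleftrightarrow>
     (\<forall>t\<in>{0..T}. \<forall>G. uniform_open T Ob G \<longrightarrow>
        (AE \<omega> in M. (\<exists>g\<in>G. \<forall>s\<in>{0..t}. g s = S s \<omega>) \<longrightarrow>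
            real_cond_exp M (F t) (indicator (path_event M T S G)) \<omega> > 0))"

definition equiv_prob :: "'a measure \<Rightarrow> 'a measure \<Rightarrow> bool" where
  "equiv_prob M Q \<longleftrightarrow> prob_space Q \<and> space Q = space M \<and> sets Q = sets M \<and>
     (\<forall>A\<in>sets M. emeasure M A = 0 \<longleftrightarrow> emeasure Q A = 0)"

definition is_martingale :: "'a measure \<Rightarrow> (real \<Rightarrow> 'a measure) \<Rightarrow> real \<Rightarrow> (real \<Rightarrow> 'a \<Rightarrow> real ^ 'n::finite) \<Rightarrow> bool" where
  "is_martingale Q F T St \<longleftrightarrow>
     (\<forall>t\<in>{0..T}. St t \<in> borel_measurable (F t)) \<and>
     (\<forall>t\<in>{0..T}. \<forall>i. integrable Q (\<lambda>\<omega>. St t \<omega> $ i)) \<and>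
     (\<forall>s t i. 0 \<le> s \<and> s \<le> t \<and> t \<le> T \<longrightarrow>
        (\<forall>A\<in>sets (F s). (\<integral>\<omega>. indicator A \<omega> * St t \<omega> $ i \<partial>Q) = (\<integral>\<omega>. indicator A \<omega> * St s \<omega> $ i \<partial>Q)))"

definition eps_cps :: "'a measure \<Rightarrow> (real \<Rightarrow> 'a measure) \<Rightarrow> real \<Rightarrow> real \<Rightarrow> (real \<Rightarrow> 'a \<Rightarrow> real ^ 'n::finite) \<Rightarrow> (real \<Rightarrow> 'a \<Rightarrow> real ^ 'n) \<Rightarrow> 'a measure \<Rightarrow> bool" where
  "eps_cps M F T \<epsilon> S St Q \<longleftrightarrow>
     equiv_prob M Q \<and> is_martingale Q F T St \<and>
     (AE \<omega> in M. \<forall>t\<in>{0..T}. \<forall>i.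
        1 / (1 + \<epsilon>) \<le> St t \<omega> $ i / S t \<omega> $ i \<and> St t \<omega> $ i / S t \<omega> $ i \<le> 1 + \<epsilon>)"

end

theory Submission
  imports Defs
begin

text \<open>
  The argument works for every open subset of the positive orthant. The path is sampled at the
  successive times at which it leaves a small sup-norm cube, of radius proportional to the distance of
  its centre from the complement of the open set. The next centre is the old one plus the radius times
  a displacement in \<open>{-1, 0, 1}\<^sup>n\<close>, obtained by rounding the exit point; displacement \<open>0\<close> means that the
  path stays in the cube up to time \<open>T\<close>, after which the walk of centres is frozen. Conditional full
  support, applied at rational times slightly after the exit times, shows that every displacement has
  positive conditional probability. Reweighting so that all displacements become equally likely
  therefore turns the walk of centres into a martingale. As displacement \<open>0\<close> then has a fixed positive
  probability, the walk freezes geometrically fast, so no mass is lost in the infinite product of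
  densities and the terminal centre is integrable. Its conditional expectation at time \<open>t\<close> lies in the
  cube that contains the path at time \<open>t\<close>, hence is close to the path in ratio and stays in the open set.
\<close>

section \<open>Cubes and sign vectors\<close>

definition closed_cube :: "real ^ 'n::finite \<Rightarrow> real \<Rightarrow> (real ^ 'n) set" where
  "closed_cube x r = cbox (x - r *\<^sub>R 1) (x + r *\<^sub>R 1)"

definition open_cube :: "real ^ 'n::finite \<Rightarrow> real \<Rightarrow> (real ^ 'n) set" where
  "open_cube x r = box (x - r *\<^sub>R 1) (x + r *\<^sub>R 1)"

lemma mem_closed_cube: "y \<in> closed_cube x r \<longleftrightarrow> (\<forall>i. \<bar>y $ i - x $ i\<bar> \<le> r)"
  by (simp add: closed_cube_def mem_box_cart abs_le_iff diff_le_eq le_diff_eq algebra_simps) blast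

lemma mem_open_cube: "y \<in> open_cube x r \<longleftrightarrow> (\<forall>i. \<bar>y $ i - x $ i\<bar> < r)"
  by (simp add: open_cube_def mem_box_cart abs_less_iff diff_less_eq less_diff_eq algebra_simps) blast

lemma closed_closed_cube: "closed (closed_cube x r)"
  by (simp add: closed_cube_def closed_cbox)

lemma open_open_cube: "open (open_cube x r)"
  by (simp add: open_cube_def open_box)

lemma convex_open_cube: "convex (open_cube x r)"
  by (simp add: open_cube_def)

lemma interior_closed_cube: "interior (closed_cube x r) = open_cube x r"
  by (simp add: closed_cube_def open_cube_def interior_cbox)

lemma open_cube_subset_closed_cube: "open_cube x r \<subseteq> closed_cube x r"
  by (simp add: closed_cube_def open_cube_def box_subset_cbox)

lemma closed_cube_mono: "r \<le> r' \<Longrightarrow> closed_cube x r \<subseteq> closed_cube x r'"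
  unfolding subset_iff mem_closed_cube by (meson order_trans)

lemma closed_cube_subset_open_cube: "r < r' \<Longrightarrow> closed_cube x r \<subseteq> open_cube x r'"
  unfolding subset_iff mem_closed_cube mem_open_cube by (meson le_less_trans)

lemma frontier_closed_cubeE:
  assumes "y \<in> frontier (closed_cube x r)"
  obtains i where "\<bar>y $ i - x $ i\<bar> = r"
proof -
  have "y \<in> closed_cube x r" "y \<notin> open_cube x r"
    using assms by (auto simp: frontier_def interior_closed_cube closure_closed[OF closed_closed_cube])
  then show ?thesis
    unfolding mem_closed_cube mem_open_cube using that by (meson antisym not_le)
qed

lemma dist_closed_cube_le:
  fixes x y :: "real ^ 'n::finite"
  assumes "y \<in> closed_cube x r"
  shows "dist y x \<le> real CARD('n) * r"
proof -
  have "dist y x \<le> (\<Sum>i\<in>UNIV. \<bar>(y - x) $ i\<bar>)"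
    unfolding dist_norm by (rule norm_le_l1_cart)
  also have "\<dots> \<le> (\<Sum>i\<in>(UNIV::'n set). r)"
    using assms by (intro sum_mono) (simp add: mem_closed_cube)
  finally show ?thesis by simp
qed

definition sign_vectors :: "(real ^ 'n::finite) set" where
  "sign_vectors = {d. \<forall>i. d $ i \<in> {-1, 0, 1}}"

lemma finite_sign_vectors: "finite (sign_vectors :: (real ^ 'n::finite) set)"
proof -
  have "sign_vectors \<subseteq> vec_lambda ` (UNIV \<rightarrow>\<^sub>E {-1, 0, 1} :: ('n \<Rightarrow> real) set)"
  proof
    fix d :: "real ^ 'n" assume "d \<in> sign_vectors"
    then have "vec_nth d \<in> UNIV \<rightarrow>\<^sub>E {-1, 0, 1}" by (auto simp: sign_vectors_def)
    then show "d \<in> vec_lambda ` (UNIV \<rightarrow>\<^sub>E {-1, 0, 1})"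
      by (intro image_eqI[of _ _ "vec_nth d"]) simp_all
  qed
  then show ?thesis by (rule finite_subset) (intro finite_imageI finite_PiE, auto)
qed

lemma zero_in_sign_vectors: "0 \<in> sign_vectors"
  by (simp add: sign_vectors_def)

lemma card_sign_vectors_pos: "0 < card (sign_vectors :: (real ^ 'n::finite) set)"
  using finite_sign_vectors zero_in_sign_vectors by (auto simp: card_gt_0_iff)

lemma uminus_in_sign_vectors_iff: "- d \<in> sign_vectors \<longleftrightarrow> d \<in> sign_vectors"
proof -
  have "- a \<in> {-1, 0, 1} \<longleftrightarrow> a \<in> {-1, 0, 1 :: real}" for a by auto
  then show ?thesis unfolding sign_vectors_def by (simp only: mem_Collect_eq vector_uminus_component)
qed

lemma sum_sign_vectors_nth: "(\<Sum>d\<in>sign_vectors. (d :: real ^ 'n::finite) $ i) = 0"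
proof -
  have "bij_betw uminus sign_vectors (sign_vectors :: (real ^ 'n) set)"
    by (rule bij_betwI[where g = uminus]) (auto simp: uminus_in_sign_vectors_iff)
  from sum.reindex_bij_betw[OF this, of "\<lambda>d. d $ i"] show ?thesis by (simp add: sum_negf)
qed

lemma abs_sign_vector_le: "d \<in> sign_vectors \<Longrightarrow> \<bar>d $ i\<bar> \<le> 1"
  unfolding sign_vectors_def by (drule CollectD, drule spec[of _ i]) auto

lemma nonzero_sign_vectorE:
  assumes "d \<in> sign_vectors" "d \<noteq> 0"
  obtains i where "\<bar>d $ i\<bar> = 1"
proof -
  obtain i where "d $ i \<noteq> 0" using assms(2) by (auto simp: vec_eq_iff)
  moreover have "d $ i \<in> {-1, 0, 1}" using assms(1) by (simp add: sign_vectors_def)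
  ultimately show ?thesis using that[of i] by auto
qed

lemma sign_step_in_closed_cube:
  assumes "d \<in> sign_vectors" "0 \<le> r"
  shows "x + r *\<^sub>R d \<in> closed_cube x r"
  using abs_sign_vector_le[OF assms(1)] assms(2) by (simp add: mem_closed_cube abs_mult mult_left_le)

lemma sign_step_in_open_cube:
  assumes "d \<in> sign_vectors" "\<bar>s - t\<bar> < e"
  shows "x + s *\<^sub>R d \<in> open_cube (x + t *\<^sub>R d) e"
  unfolding mem_open_cube
proof
  fix i
  have "\<bar>(x + s *\<^sub>R d) $ i - (x + t *\<^sub>R d) $ i\<bar> = \<bar>s - t\<bar> * \<bar>d $ i\<bar>"
    by (simp add: left_diff_distrib flip: abs_mult)
  also have "\<dots> \<le> \<bar>s - t\<bar>" by (intro mult_left_le abs_sign_vector_le assms(1)) simp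
  finally show "\<bar>(x + s *\<^sub>R d) $ i - (x + t *\<^sub>R d) $ i\<bar> < e" using assms(2) by linarith
qed

lemma sign_step_notin_closed_cube:
  assumes "d \<in> sign_vectors" "d \<noteq> 0" "r < s" "0 \<le> r"
  shows "x + s *\<^sub>R d \<notin> closed_cube x r"
proof -
  obtain i where "\<bar>d $ i\<bar> = 1" by (rule nonzero_sign_vectorE[OF assms(1,2)])
  then have "r < \<bar>(x + s *\<^sub>R d) $ i - x $ i\<bar>" using assms(3,4) by (simp add: abs_mult)
  then show ?thesis unfolding mem_closed_cube by (meson not_le)
qed

definition round_vec :: "real ^ 'n::finite \<Rightarrow> real ^ 'n" where
  "round_vec y = (\<chi> i. real_of_int (round (y $ i)))"

lemma abs_diff_round_vec_le: "\<bar>y $ i - round_vec y $ i\<bar> \<le> 1 / 2"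
  using of_int_round_abs_le[of "y $ i"] by (simp add: round_vec_def abs_minus_commute)

lemma round_vec_in_sign_vectors:
  assumes "\<And>i. \<bar>y $ i\<bar> \<le> 1"
  shows "round_vec y \<in> sign_vectors"
proof -
  have "real_of_int (round (y $ i)) \<in> {-1, 0, 1}" for i
  proof -
    have "round (y $ i) \<le> round (1::real)" "round (-1::real) \<le> round (y $ i)"
      using assms[of i] by (intro round_mono; simp add: abs_le_iff)+
    moreover have "round (1::real) = 1" "round (-1::real) = -1"
      by (auto intro: round_unique')
    ultimately have "round (y $ i) \<in> {-1, 0, 1}" by auto
    then show ?thesis by auto
  qed
  then show ?thesis by (simp add: sign_vectors_def round_vec_def)
qed

lemma round_vec_eq_sign_vectorI:
  assumes "d \<in> sign_vectors" "\<And>i. \<bar>y $ i - d $ i\<bar> < 1 / 2"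
  shows "round_vec y = d"
proof -
  have "real_of_int (round (y $ i)) = d $ i" for i
  proof -
    have "d $ i \<in> \<int>" using assms(1) by (auto simp: sign_vectors_def dest: spec[of _ i])
    then obtain m :: int where "d $ i = real_of_int m" by (rule Ints_cases)
    then show ?thesis using assms(2)[of i] round_unique'[of "y $ i" m] by simp
  qed
  then show ?thesis by (simp add: round_vec_def vec_eq_iff)
qed

lemma round_vec_nonzero:
  assumes "\<bar>y $ i\<bar> = 1"
  shows "round_vec y \<noteq> 0"
  using abs_diff_round_vec_le[of y i] assms by auto

section \<open>Measurability and conditional expectation\<close>

lemma borel_measurable_vec_iff:
  fixes f :: "'a \<Rightarrow> real ^ 'n::finite"
  shows "f \<in> borel_measurable N \<longleftrightarrow> (\<forall>i. (\<lambda>\<omega>. f \<omega> $ i) \<in> borel_measurable N)"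
  unfolding borel_measurable_euclidean_space[of f]
  by (auto simp: Basis_vec_def inner_axis)

lemma borel_measurable_vec_nth [measurable (raw)]:
  fixes f :: "'a \<Rightarrow> real ^ 'n::finite"
  shows "f \<in> borel_measurable N \<Longrightarrow> (\<lambda>\<omega>. f \<omega> $ i) \<in> borel_measurable N"
  using borel_measurable_vec_iff by blast

lemma borel_measurable_round_vec [measurable (raw)]:
  fixes f :: "'a \<Rightarrow> real ^ 'n::finite"
  assumes [measurable]: "f \<in> borel_measurable N"
  shows "(\<lambda>\<omega>. round_vec (f \<omega>)) \<in> borel_measurable N"
  unfolding borel_measurable_vec_iff round_vec_def round_def by simp

lemma borel_measurable_at_random_time:
  fixes X :: "real \<Rightarrow> 'a \<Rightarrow> 'b::metric_space"
  assumes v [measurable]: "v \<in> borel_measurable N" and v_le: "\<And>\<omega>. v \<omega> \<le> t"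
    and X: "\<And>s. s \<le> t \<Longrightarrow> X s \<in> borel_measurable N"
    and cont: "\<And>\<omega>. \<omega> \<in> space N \<Longrightarrow> continuous_on {..t} (\<lambda>s. X s \<omega>)"
  shows "(\<lambda>\<omega>. X (v \<omega>) \<omega>) \<in> borel_measurable N"
proof -
  define dyadic :: "nat \<Rightarrow> int \<Rightarrow> real" where "dyadic m i = min t (real_of_int i / 2 ^ m)" for m i
  have [measurable]: "X (dyadic m i) \<in> borel_measurable N" for m i
    by (intro X) (simp add: dyadic_def)
  define q where "q m \<omega> = dyadic m \<lceil>2 ^ m * v \<omega>\<rceil>" for m \<omega>
  have "(\<lambda>\<omega>. X (q m \<omega>) \<omega>) \<in> borel_measurable N" for m
    unfolding q_def
    by (rule measurable_compose_countable[where f = "\<lambda>i \<omega>. X (dyadic m i) \<omega>"]) measurable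
  moreover have "(\<lambda>m. X (q m \<omega>) \<omega>) \<longlonglongrightarrow> X (v \<omega>) \<omega>" if \<omega>: "\<omega> \<in> space N" for \<omega>
  proof -
    have bounds: "v \<omega> \<le> q m \<omega>" "q m \<omega> \<le> v \<omega> + (1/2) ^ m" for m
      using v_le[of \<omega>] ceiling_correct[of "2 ^ m * v \<omega>"]
      by (auto simp: q_def dyadic_def min_le_iff_disj field_simps)
    have "(\<lambda>m. v \<omega> + (1/2) ^ m) \<longlonglongrightarrow> v \<omega> + 0"
      by (intro tendsto_add tendsto_const LIMSEQ_power_zero) simp
    then have upper: "(\<lambda>m. v \<omega> + (1/2) ^ m) \<longlonglongrightarrow> v \<omega>" by simp
    have "(\<lambda>m. q m \<omega>) \<longlonglongrightarrow> v \<omega>"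
      by (rule tendsto_sandwich[OF _ _ tendsto_const upper]) (simp_all add: bounds)
    moreover have "q m \<omega> \<in> {..t}" for m by (simp add: q_def dyadic_def)
    ultimately show ?thesis
      using cont[OF \<omega>] v_le[of \<omega>] unfolding continuous_on_sequentially by (auto simp: o_def)
  qed
  ultimately show ?thesis by (rule borel_measurable_LIMSEQ_metric)
qed

lemma path_stays_in_open_iff:
  fixes g :: "real \<Rightarrow> 'b::euclidean_space"
  assumes "a < b" and g: "continuous_on {a..b} g" and W: "open W" "W \<noteq> UNIV"
  shows "(\<forall>s\<in>{a..b}. g s \<in> W) \<longleftrightarrow> (\<exists>m. \<forall>s\<in>{a<..<b} \<inter> \<rat>. 1 / real (Suc m) \<le> infdist (g s) (- W))"
proof
  assume in_W: "\<forall>s\<in>{a..b}. g s \<in> W"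
  have "continuous_on {a..b} (\<lambda>s. infdist (g s) (- W))" by (intro continuous_intros g)
  then obtain s0 where s0: "s0 \<in> {a..b}"
    "\<And>s. s \<in> {a..b} \<Longrightarrow> infdist (g s0) (- W) \<le> infdist (g s) (- W)"
    using continuous_attains_inf[of "{a..b}" "\<lambda>s. infdist (g s) (- W)"] \<open>a < b\<close> by auto
  have "0 < infdist (g s0) (- W)"
    using s0(1) in_W W by (intro infdist_pos_not_in_closed) auto
  then obtain m where "1 / real (Suc m) < infdist (g s0) (- W)" using nat_approx_posE by blast
  then have "1 / real (Suc m) \<le> infdist (g s) (- W)" if "s \<in> {a..b}" for s
    using s0(2)[OF that] by simp
  then show "\<exists>m. \<forall>s\<in>{a<..<b} \<inter> \<rat>. 1 / real (Suc m) \<le> infdist (g s) (- W)"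
    by (intro exI[of _ m]) auto
next
  assume "\<exists>m. \<forall>s\<in>{a<..<b} \<inter> \<rat>. 1 / real (Suc m) \<le> infdist (g s) (- W)"
  then obtain m where m: "g ` ({a<..<b} \<inter> \<rat>) \<subseteq> {y. 1 / real (Suc m) \<le> infdist y (- W)}" by blast
  have closure: "closure ({a<..<b} \<inter> \<rat>) = {a..b}"
    using \<open>a < b\<close> closure_open_Int_superset[of "{a<..<b}" "\<rat>"] by (simp add: Rats_closure_real)
  have "closed {y. 1 / real (Suc m) \<le> infdist y (- W)}"
    by (intro closed_Collect_le continuous_intros)
  then have "g ` {a..b} \<subseteq> {y. 1 / real (Suc m) \<le> infdist y (- W)}"
    using image_closure_subset[OF _ _ m] g unfolding closure by blast
  moreover have "{y. 1 / real (Suc m) \<le> infdist y (- W)} \<subseteq> W"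
    by (rule subsetI, rule ccontr) simp
  ultimately show "\<forall>s\<in>{a..b}. g s \<in> W" by blast
qed

lemma sets_path_stays_in_open:
  fixes X :: "real \<Rightarrow> 'a \<Rightarrow> 'b::euclidean_space"
  assumes "a < b" and X: "\<And>s. s \<in> {a..b} \<Longrightarrow> X s \<in> borel_measurable M"
    and cont: "\<And>\<omega>. \<omega> \<in> space M \<Longrightarrow> continuous_on {a..b} (\<lambda>s. X s \<omega>)"
    and W: "open W" "W \<noteq> UNIV"
  shows "{\<omega> \<in> space M. \<forall>s\<in>{a..b}. X s \<omega> \<in> W} \<in> sets M"
proof -
  have "{\<omega> \<in> space M. \<forall>s\<in>{a..b}. X s \<omega> \<in> W}
      = {\<omega> \<in> space M. \<exists>m. \<forall>s\<in>{a<..<b} \<inter> \<rat>. 1 / real (Suc m) \<le> infdist (X s \<omega>) (- W)}"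
    using path_stays_in_open_iff[OF \<open>a < b\<close> cont W] by blast
  also have "\<dots> \<in> sets M"
  proof (intro sets.sets_Collect_countable_Ex sets.sets_Collect_countable_All')
    show "countable ({a<..<b} \<inter> \<rat>)" by (intro countable_Int2 countable_rat)
    fix m s assume "s \<in> {a<..<b} \<inter> \<rat>"
    then have [measurable]: "X s \<in> borel_measurable M" by (intro X) auto
    have [measurable]: "(\<lambda>y. infdist y (- W)) \<in> borel_measurable borel"
      by (intro borel_measurable_continuous_onI continuous_intros)
    show "{\<omega> \<in> space M. 1 / real (Suc m) \<le> infdist (X s \<omega>) (- W)} \<in> sets M" by measurable
  qed
  finally show ?thesis .
qed

lemma (in prob_space) AE_iff_of_trivial:
  assumes "prob {\<omega> \<in> space M. P \<omega>} \<in> {0, 1}" and [measurable]: "Measurable.pred M P"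
  shows "AE \<omega> in M. P \<omega> \<longleftrightarrow> prob {\<omega> \<in> space M. P \<omega>} = 1"
proof (cases "prob {\<omega> \<in> space M. P \<omega>} = 1")
  case True
  then have "AE \<omega> in M. P \<omega>" by (subst prob_Collect_eq_1[symmetric]) simp_all
  then show ?thesis using True by simp
next
  case False
  then have "AE \<omega> in M. \<not> P \<omega>" using assms(1) by (subst prob_Collect_eq_0[symmetric]) simp_all
  then show ?thesis using False by simp
qed

lemma (in prob_space) AE_constant_of_trivial_preimages:
  fixes f :: "'a \<Rightarrow> 'b::{second_countable_topology, t0_space}"
  assumes trivial: "\<And>U. open U \<Longrightarrow> prob {\<omega> \<in> space M. f \<omega> \<in> U} \<in> {0, 1}"
    and f [measurable]: "f \<in> borel_measurable M"
  obtains c where "AE \<omega> in M. f \<omega> = c"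
proof -
  obtain B :: "'b set set" where B: "countable B" "topological_basis B"
    using ex_countable_basis by blast
  have "AE \<omega> in M. f \<omega> \<in> U \<longleftrightarrow> prob {\<omega> \<in> space M. f \<omega> \<in> U} = 1" if "U \<in> B" for U
  proof -
    have U: "open U" using B(2) that by (rule topological_basis_open)
    then have [measurable]: "U \<in> sets borel" by simp
    show ?thesis by (rule AE_iff_of_trivial[OF trivial[OF U]]) measurable
  qed
  then have determined: "AE \<omega> in M. \<forall>U\<in>B. f \<omega> \<in> U \<longleftrightarrow> prob {\<omega> \<in> space M. f \<omega> \<in> U} = 1"
    by (simp add: AE_ball_countable[OF B(1)])
  then obtain \<omega>0 where \<omega>0: "\<forall>U\<in>B. f \<omega>0 \<in> U \<longleftrightarrow> prob {\<omega> \<in> space M. f \<omega> \<in> U} = 1"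
    using eventually_happens'[OF ae_filter_bot determined] by blast
  from determined have "AE \<omega> in M. f \<omega> = f \<omega>0"
  proof eventually_elim
    case (elim \<omega>)
    show ?case
    proof (rule ccontr)
      assume "f \<omega> \<noteq> f \<omega>0"
      then obtain V where V: "open V" "f \<omega> \<in> V \<longleftrightarrow> f \<omega>0 \<notin> V"
        by (auto simp: separation_t0)
      then obtain y where y: "y \<in> V" "y \<in> {f \<omega>, f \<omega>0}" by blast
      obtain U where "U \<in> B" "y \<in> U" "U \<subseteq> V" using topological_basisE[OF B(2) V(1) y(1)] .
      then show False using elim \<omega>0 V(2) y(2) by blast
    qed
  qed
  then show ?thesis by (rule that)
qed

lemma (in sigma_finite_subalgebra) real_cond_exp_between_on:
  assumes f: "integrable M f" and g: "integrable M g" and C: "C \<in> sets F" and C_fin: "emeasure M C < \<infinity>"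
    and eq: "\<And>A. A \<in> sets F \<Longrightarrow> A \<subseteq> C \<Longrightarrow>
      (\<integral>\<omega>. indicator A \<omega> * f \<omega> \<partial>M) = (\<integral>\<omega>. indicator A \<omega> * g \<omega> \<partial>M)"
    and bounds: "\<And>\<omega>. \<omega> \<in> C \<Longrightarrow> l \<le> g \<omega> \<and> g \<omega> \<le> u"
  shows "AE \<omega> in M. \<omega> \<in> C \<longrightarrow> l \<le> real_cond_exp M F f \<omega> \<and> real_cond_exp M F f \<omega> \<le> u"
proof -
  have [measurable]: "C \<in> sets F" "C \<in> sets M" "f \<in> borel_measurable M" "g \<in> borel_measurable M"
    using C subalg f g by (auto simp: subalgebra_def)
  let ?on = "\<lambda>h \<omega>. indicator C \<omega> * (h \<omega> :: real)"
  have int: "integrable M (?on h)" if "integrable M h" for h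
    using integrable_real_mult_indicator[OF \<open>C \<in> sets M\<close> that] by (simp add: mult.commute)
  have int_const: "integrable M (?on (\<lambda>_. a))" for a
    using C_fin by (intro integrable_mult_left integrable_real_indicator) simp_all
  have const: "AE \<omega> in M. real_cond_exp M F (?on (\<lambda>_. a)) \<omega> = ?on (\<lambda>_. a) \<omega>" for a
    by (intro real_cond_exp_F_meas int_const) measurable
  have "AE \<omega> in M. real_cond_exp M F (?on f) \<omega> = real_cond_exp M F (?on g) \<omega>"
  proof (rule real_cond_exp_charact)
    fix A assume A: "A \<in> sets F"
    have "(\<integral>\<omega>\<in>A. ?on f \<omega> \<partial>M) = (\<integral>\<omega>\<in>A. ?on g \<omega> \<partial>M)"
      using eq[of "A \<inter> C"] A C
      by (simp add: set_lebesgue_integral_def indicator_inter_arith mult.assoc)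
    also have "\<dots> = (\<integral>\<omega>\<in>A. real_cond_exp M F (?on g) \<omega> \<partial>M)"
      by (intro real_cond_exp_intA int g A)
    finally show "(\<integral>\<omega>\<in>A. ?on f \<omega> \<partial>M) = (\<integral>\<omega>\<in>A. real_cond_exp M F (?on g) \<omega> \<partial>M)" .
  qed (simp_all add: int f g real_cond_exp_int(1))
  moreover have "AE \<omega> in M. real_cond_exp M F (?on f) \<omega> = ?on (real_cond_exp M F f) \<omega>"
    by (intro real_cond_exp_mult int f) measurable
  moreover have "AE \<omega> in M. real_cond_exp M F (?on (\<lambda>_. l)) \<omega> \<le> real_cond_exp M F (?on g) \<omega>"
    using bounds by (intro real_cond_exp_mono int g int_const AE_I2) (simp add: indicator_def)
  moreover have "AE \<omega> in M. real_cond_exp M F (?on g) \<omega> \<le> real_cond_exp M F (?on (\<lambda>_. u)) \<omega>"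
    using bounds by (intro real_cond_exp_mono int g int_const AE_I2) (simp add: indicator_def)
  ultimately show ?thesis using const[of l] const[of u] by eventually_elim auto
qed

lemma (in finite_measure_subalgebra) emeasure_Int_nonzero_of_cond_exp_pos:
  assumes B: "B \<in> sets F" "emeasure M B \<noteq> 0" and E: "E \<in> sets M"
    and pos: "AE \<omega> in M. \<omega> \<in> B \<longrightarrow> 0 < real_cond_exp M F (indicator E) \<omega>"
  shows "emeasure M (B \<inter> E) \<noteq> 0"
proof
  let ?r = "real_cond_exp M F (indicator E)"
  assume null: "emeasure M (B \<inter> E) = 0"
  have B_in_M: "B \<in> sets M" using B(1) subalg by (auto simp: subalgebra_def)
  have int: "integrable M (indicator E :: 'a \<Rightarrow> real)"
    using E by (intro integrable_real_indicator) (simp_all add: less_top[symmetric])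
  have "(\<integral>\<omega>. indicator B \<omega> * ?r \<omega> \<partial>M) = (\<integral>\<omega>. indicator (B \<inter> E) \<omega> \<partial>M)"
    using real_cond_exp_intA[OF int B(1)]
    by (simp add: set_lebesgue_integral_def indicator_inter_arith)
  also have "\<dots> = 0" using null B_in_M E by (simp add: measure_def)
  finally have "(\<integral>\<omega>. indicator B \<omega> * ?r \<omega> \<partial>M) = 0" .
  moreover have "integrable M (\<lambda>\<omega>. indicator B \<omega> * ?r \<omega>)"
    using integrable_real_mult_indicator[OF B_in_M real_cond_exp_int(1)[OF int]] by (simp add: mult.commute)
  moreover have "AE \<omega> in M. 0 \<le> indicator B \<omega> * ?r \<omega>"
    using pos by eventually_elim (auto simp: indicator_def)
  ultimately have "AE \<omega> in M. indicator B \<omega> * ?r \<omega> = 0"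
    using integral_nonneg_eq_0_iff_AE by blast
  with pos have "AE \<omega> in M. \<omega> \<notin> B" by eventually_elim (auto simp: indicator_def split: if_splits)
  then have "B \<in> null_sets M" by (simp add: AE_iff_null_sets[OF B_in_M])
  then show False using B(2) by blast
qed

lemma (in sigma_finite_subalgebra) version_of_real_cond_exp:
  assumes Y: "integrable M Y" and X: "X \<in> borel_measurable F"
    and eq: "AE \<omega> in M. X \<omega> = real_cond_exp M F Y \<omega>"
  shows "integrable M X"
    and "A \<in> sets F \<Longrightarrow> (\<integral>\<omega>. indicator A \<omega> * X \<omega> \<partial>M) = (\<integral>\<omega>. indicator A \<omega> * Y \<omega> \<partial>M)"
proof -
  have [measurable]: "X \<in> borel_measurable M" by (rule measurable_from_subalg[OF subalg X])
  show "integrable M X"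
  proof (rule integrable_cong_AE_imp[OF real_cond_exp_int(1)[OF Y]])
    show "AE \<omega> in M. real_cond_exp M F Y \<omega> = X \<omega>" using eq by eventually_elim simp
  qed measurable
  assume A: "A \<in> sets F"
  then have [measurable]: "A \<in> sets M" using subalg by (auto simp: subalgebra_def)
  have "(\<integral>\<omega>. indicator A \<omega> * X \<omega> \<partial>M) = (\<integral>\<omega>. indicator A \<omega> * real_cond_exp M F Y \<omega> \<partial>M)"
    using eq by (intro integral_cong_AE) (measurable, auto)
  also have "\<dots> = (\<integral>\<omega>. indicator A \<omega> * Y \<omega> \<partial>M)"
    using real_cond_exp_intA[OF Y A] by (simp add: set_lebesgue_integral_def)
  finally show "(\<integral>\<omega>. indicator A \<omega> * X \<omega> \<partial>M) = (\<integral>\<omega>. indicator A \<omega> * Y \<omega> \<partial>M)" .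
qed

lemma is_martingale_of_cond_exp:
  fixes St :: "real \<Rightarrow> 'a \<Rightarrow> real ^ 'n::finite"
  assumes sub: "\<And>t. t \<in> {0..T} \<Longrightarrow> sigma_finite_subalgebra Q (F t)"
    and mono: "\<And>s t. 0 \<le> s \<Longrightarrow> s \<le> t \<Longrightarrow> t \<le> T \<Longrightarrow> sets (F s) \<subseteq> sets (F t)"
    and Y: "\<And>i. integrable Q (Y i)"
    and St: "\<And>t. t \<in> {0..T} \<Longrightarrow> St t \<in> borel_measurable (F t)"
    and St_eq: "\<And>t i. t \<in> {0..T} \<Longrightarrow> AE \<omega> in Q. St t \<omega> $ i = real_cond_exp Q (F t) (Y i) \<omega>"
  shows "is_martingale Q F T St"
proof -
  have St_nth: "(\<lambda>\<omega>. St t \<omega> $ i) \<in> borel_measurable (F t)" if "t \<in> {0..T}" for t i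
    using St[OF that] by measurable
  note version = sigma_finite_subalgebra.version_of_real_cond_exp[OF sub Y St_nth St_eq]
  show ?thesis
    unfolding is_martingale_def
  proof (intro conjI ballI allI impI)
    fix s t i A assume st: "0 \<le> s \<and> s \<le> t \<and> t \<le> T" and A: "A \<in> sets (F s)"
    then have "A \<in> sets (F t)" using mono[of s t] by auto
    then show "(\<integral>\<omega>. indicator A \<omega> * St t \<omega> $ i \<partial>Q) = (\<integral>\<omega>. indicator A \<omega> * St s \<omega> $ i \<partial>Q)"
      using version(2)[of t A i] version(2)[of s A i] st A by simp
  qed (use St version(1) in auto)
qed

section \<open>Stopping times\<close>

lemma (in filtration) borel_measurable_pre_sigma_restrict:
  fixes f :: "'a \<Rightarrow> 'b::{topological_space, zero}"
  assumes \<tau>: "stopping_time F \<tau>" and f: "f \<in> borel_measurable (pre_sigma \<tau>)"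
  shows "(\<lambda>\<omega>. if \<tau> \<omega> \<le> t then f \<omega> else 0) \<in> borel_measurable (F t)"
proof (rule measurableI)
  fix B :: "'b set" assume B: "B \<in> sets borel"
  have before: "{\<omega> \<in> f -` B \<inter> \<Omega>. \<tau> \<omega> \<le> t} \<in> sets (F t)"
    using sets_pre_sigmaD[OF \<tau> measurable_sets[OF f B]] by (simp add: space_pre_sigma)
  have after: "{\<omega> \<in> \<Omega>. t < \<tau> \<omega>} \<in> sets (F t)"
    using stopping_timeD2[OF \<tau>, of t] by (simp add: pred_def space_F)
  have "(\<lambda>\<omega>. if \<tau> \<omega> \<le> t then f \<omega> else 0) -` B \<inter> space (F t) =
    {\<omega> \<in> f -` B \<inter> \<Omega>. \<tau> \<omega> \<le> t} \<union> (if 0 \<in> B then {\<omega> \<in> \<Omega>. t < \<tau> \<omega>} else {})"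
    by (auto simp: space_F split: if_splits)
  then show "(\<lambda>\<omega>. if \<tau> \<omega> \<le> t then f \<omega> else 0) -` B \<inter> space (F t) \<in> sets (F t)"
    using before after by auto
qed simp

lemma (in filtration) sets_pre_sigma_before:
  assumes \<tau>: "stopping_time F \<tau>" and A: "A \<in> sets (pre_sigma \<tau>)"
  shows "{\<omega> \<in> A. \<tau> \<omega> < t} \<in> sets (F t)"
proof -
  have "{\<omega> \<in> A. \<tau> \<omega> \<le> t} \<inter> {\<omega> \<in> space (F t). \<tau> \<omega> < t} \<in> sets (F t)"
    using sets_pre_sigmaD[OF \<tau> A, of t] stopping_time_less_const[OF \<tau>, of t]
    by (auto simp: pred_def)
  also have "{\<omega> \<in> A. \<tau> \<omega> \<le> t} \<inter> {\<omega> \<in> space (F t). \<tau> \<omega> < t} = {\<omega> \<in> A. \<tau> \<omega> < t}"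
    using sets.sets_into_space[OF A] by (auto simp: space_F space_pre_sigma)
  finally show ?thesis .
qed

lemma (in filtration) sets_pre_sigma_of_after:
  assumes \<tau>: "stopping_time F \<tau>" and A: "A \<in> sets (F t)" "\<And>\<omega>. \<omega> \<in> A \<Longrightarrow> t \<le> \<tau> \<omega>"
  shows "A \<in> sets (pre_sigma \<tau>)"
proof (rule sets_pre_sigmaI[OF \<tau>])
  fix u
  show "{\<omega> \<in> A. \<tau> \<omega> \<le> u} \<in> sets (F u)"
  proof (cases "t \<le> u")
    case True
    then have "A \<inter> {\<omega> \<in> space (F u). \<tau> \<omega> \<le> u} \<in> sets (F u)"
      using sets_F_mono[OF True] A(1) stopping_timeD[OF \<tau>, of u] by (auto simp: pred_def)
    also have "A \<inter> {\<omega> \<in> space (F u). \<tau> \<omega> \<le> u} = {\<omega> \<in> A. \<tau> \<omega> \<le> u}"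
      using sets.sets_into_space[OF A(1)] by (auto simp: space_F)
    finally show ?thesis .
  next
    case False
    then have "{\<omega> \<in> A. \<tau> \<omega> \<le> u} = {}" using A(2) by fastforce
    then show ?thesis by (simp only: sets.empty_sets)
  qed
qed

locale real_filtration = filtration \<Omega> F
  for \<Omega> :: "'a set" and F :: "real \<Rightarrow> 'a measure"
begin

lemma stopping_time_of_right_continuous:
  assumes right_continuous: "\<And>t. (\<Inter>s\<in>{t<..}. sets (F s)) \<subseteq> sets (F t)"
    and less: "\<And>t. {\<omega> \<in> \<Omega>. \<tau> \<omega> < t} \<in> sets (F t)"
  shows "stopping_time F \<tau>"
proof
  fix t
  have "{\<omega> \<in> \<Omega>. \<tau> \<omega> \<le> t} \<in> sets (F s)" if "t < s" for s
  proof -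
    have "\<tau> \<omega> \<le> t \<longleftrightarrow> (\<forall>n. \<tau> \<omega> < t + (s - t) / real (Suc n))" for \<omega>
    proof
      assume "\<forall>n. \<tau> \<omega> < t + (s - t) / real (Suc n)"
      moreover have "(\<lambda>n. t + (s - t) / real (Suc n)) \<longlonglongrightarrow> t"
        using tendsto_add[OF tendsto_const LIMSEQ_Suc[OF lim_const_over_n[of "s - t"]], of t] by simp
      ultimately show "\<tau> \<omega> \<le> t" by (intro LIMSEQ_le_const) (auto intro: less_imp_le)
    qed (use \<open>t < s\<close> in \<open>auto intro: le_less_trans simp del: of_nat_Suc\<close>)
    then have "{\<omega> \<in> \<Omega>. \<tau> \<omega> \<le> t} = (\<Inter>n. {\<omega> \<in> \<Omega>. \<tau> \<omega> < t + (s - t) / real (Suc n)})" by auto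
    also have "\<dots> \<in> sets (F s)"
    proof (intro sets.countable_INT subsetI)
      fix A assume "A \<in> range (\<lambda>n. {\<omega> \<in> \<Omega>. \<tau> \<omega> < t + (s - t) / real (Suc n)})"
      then obtain n where A: "A = {\<omega> \<in> \<Omega>. \<tau> \<omega> < t + (s - t) / real (Suc n)}" by blast
      have "(s - t) / real (Suc n) \<le> s - t" using \<open>t < s\<close> by (simp add: divide_le_eq)
      then show "A \<in> sets (F s)"
        unfolding A using less sets_F_mono[of "t + (s - t) / real (Suc n)" s] by auto
    qed simp
    finally show ?thesis .
  qed
  then show "Measurable.pred (F t) (\<lambda>\<omega>. \<tau> \<omega> \<le> t)"
    using right_continuous[of t] by (auto simp: pred_def space_F)
qed

lemma borel_measurable_pre_sigma_at_stopping_time: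
  fixes X :: "real \<Rightarrow> 'a \<Rightarrow> 'b::metric_space"
  assumes \<tau>: "stopping_time F \<tau>"
    and X: "\<And>t. X t \<in> borel_measurable (F t)"
    and cont: "\<And>\<omega>. \<omega> \<in> \<Omega> \<Longrightarrow> continuous_on UNIV (\<lambda>t. X t \<omega>)"
  shows "(\<lambda>\<omega>. X (\<tau> \<omega>) \<omega>) \<in> borel_measurable (pre_sigma \<tau>)"
proof (rule measurableI)
  fix B :: "'b set" assume B: "B \<in> sets borel"
  show "(\<lambda>\<omega>. X (\<tau> \<omega>) \<omega>) -` B \<inter> space (pre_sigma \<tau>) \<in> sets (pre_sigma \<tau>)"
  proof (rule sets_pre_sigmaI[OF \<tau>])
    fix t
    have [measurable]: "(\<lambda>\<omega>. min (\<tau> \<omega>) t) \<in> borel_measurable (F t)"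
    proof (rule borel_measurableI_le)
      show "{\<omega> \<in> space (F t). min (\<tau> \<omega>) t \<le> s} \<in> sets (F t)" for s
        using stopping_time_le_const[OF \<tau>, of s t] by (cases "s \<le> t") (auto simp: pred_def min_le_iff_disj)
    qed
    have [measurable]: "(\<lambda>\<omega>. X (min (\<tau> \<omega>) t) \<omega>) \<in> borel_measurable (F t)"
    proof (rule borel_measurable_at_random_time)
      show "X s \<in> borel_measurable (F t)" if "s \<le> t" for s
        using X[of s] sets_F_mono[OF that] by (auto simp: measurable_def space_F)
    qed (auto simp: space_F intro: continuous_on_subset[OF cont])
    have [measurable]: "Measurable.pred (F t) (\<lambda>\<omega>. \<tau> \<omega> \<le> t)" by (rule stopping_timeD[OF \<tau>])
    note [measurable] = B
    have "{\<omega> \<in> space (F t). X (min (\<tau> \<omega>) t) \<omega> \<in> B \<and> \<tau> \<omega> \<le> t} \<in> sets (F t)" by measurable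
    also have "{\<omega> \<in> space (F t). X (min (\<tau> \<omega>) t) \<omega> \<in> B \<and> \<tau> \<omega> \<le> t} =
        {\<omega> \<in> (\<lambda>\<omega>. X (\<tau> \<omega>) \<omega>) -` B \<inter> space (pre_sigma \<tau>). \<tau> \<omega> \<le> t}"
      by (auto simp: space_F space_pre_sigma min_def)
    finally show "{\<omega> \<in> (\<lambda>\<omega>. X (\<tau> \<omega>) \<omega>) -` B \<inter> space (pre_sigma \<tau>). \<tau> \<omega> \<le> t} \<in> sets (F t)" .
  qed
qed simp

end

section \<open>First exit times\<close>

definition exit_time :: "real \<Rightarrow> (real \<Rightarrow> 'a) \<Rightarrow> real \<Rightarrow> 'a set \<Rightarrow> real" where
  "exit_time T g a C = Inf (insert T {s. a < s \<and> g s \<notin> C})"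

lemma bdd_below_exit_time: "bdd_below (insert (T :: real) {s. a < s \<and> g s \<notin> C})"
  by (intro bdd_belowI[of _ "min a T"]) auto

lemma exit_time_le: "exit_time T g a C \<le> T"
  unfolding exit_time_def by (intro cInf_lower bdd_below_exit_time) auto

lemma exit_time_ge: "a \<le> T \<Longrightarrow> a \<le> exit_time T g a C"
  unfolding exit_time_def by (intro cInf_greatest) auto

lemma exit_time_less_iff: "exit_time T g a C < t \<longleftrightarrow> T < t \<or> (\<exists>s. a < s \<and> s < t \<and> g s \<notin> C)"
  unfolding exit_time_def by (subst cInf_less_iff[OF _ bdd_below_exit_time]) auto

lemma before_exit_time:
  assumes "a < s" "s < exit_time T g a C"
  shows "g s \<in> C"
  using exit_time_less_iff[of T g a C "exit_time T g a C"] exit_time_le[of T g a C] assms by auto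

lemma exit_time_less_iff_Rats:
  assumes "continuous_on UNIV g" "closed C"
  shows "exit_time T g a C < t \<longleftrightarrow> T < t \<or> (\<exists>q\<in>\<rat>. a < q \<and> q < t \<and> g q \<notin> C)"
proof -
  have "\<exists>q\<in>\<rat>. a < q \<and> q < t \<and> g q \<notin> C" if "a < s" "s < t" "g s \<notin> C" for s
  proof -
    have "open ({a<..<t} \<inter> g -` (- C))"
      using open_vimage[OF open_Compl[OF assms(2)] assms(1)] by (intro open_Int) auto
    moreover have "s \<in> {a<..<t} \<inter> g -` (- C)" "s \<in> closure \<rat>"
      using that by (auto simp: Rats_closure_real)
    ultimately have "\<rat> \<inter> ({a<..<t} \<inter> g -` (- C)) \<noteq> {}" by (meson closure_iff_nhds_not_empty subset_refl)
    then show ?thesis by auto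
  qed
  then show ?thesis unfolding exit_time_less_iff by blast
qed

lemma exit_time_gt:
  assumes "continuous_on UNIV g" "u < T" "\<And>s. a < s \<Longrightarrow> s \<le> u \<Longrightarrow> g s \<in> C" "g u \<in> interior C"
  shows "u < exit_time T g a C"
proof -
  have "open (g -` interior C)" by (rule open_vimage[OF open_interior assms(1)])
  then obtain e where e: "e > 0" "ball u e \<subseteq> g -` interior C"
    using assms(4) by (auto elim: openE)
  have "\<not> exit_time T g a C < min T (u + e)"
  proof
    assume "exit_time T g a C < min T (u + e)"
    then obtain s where s: "a < s" "s < u + e" "g s \<notin> C" unfolding exit_time_less_iff by auto
    then have "u < s" using assms(3) by (meson not_le)
    then have "s \<in> ball u e" using s(2) by (simp add: dist_real_def)
    then show False using e(2) s(3) interior_subset by blast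
  qed
  then show ?thesis using e(1) assms(2) by auto
qed

lemma until_exit_time:
  assumes g: "continuous_on UNIV g" and C: "closed C" and "a < s" "s \<le> exit_time T g a C"
  shows "g s \<in> C"
proof (cases "s < exit_time T g a C")
  case False
  then have s: "s = exit_time T g a C" using assms by simp
  have "g ` closure {a<..<s} \<subseteq> C"
    using before_exit_time s by (intro image_closure_subset[OF continuous_on_subset[OF g] C]) auto
  then show ?thesis using \<open>a < s\<close> by auto
qed (use before_exit_time assms in blast)

lemma at_exit_time_frontier:
  assumes g: "continuous_on UNIV g" and C: "closed C"
    and "a < exit_time T g a C" "exit_time T g a C < T"
  shows "g (exit_time T g a C) \<in> frontier C"
proof -
  let ?s = "exit_time T g a C"
  have "g ?s \<notin> interior C"
  proof
    assume "g ?s \<in> interior C"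
    moreover have "open (g -` interior C)" by (rule open_vimage[OF open_interior g])
    ultimately obtain e where e: "e > 0" "ball ?s e \<subseteq> g -` interior C" by (auto elim: openE)
    have "?s < min T (?s + e)" using e(1) assms(4) by simp
    then obtain s where s: "a < s" "s < ?s + e" "g s \<notin> C" unfolding exit_time_less_iff by auto
    then have "?s \<le> s" using before_exit_time[of a s T g C] by force
    then have "s \<in> ball ?s e" using s(2) by (simp add: dist_real_def)
    then show False using e(2) s(3) interior_subset by blast
  qed
  then show ?thesis
    using until_exit_time[OF g C assms(3) order_refl] C by (simp add: frontier_def)
qed

section \<open>Cubes inscribed in an open set\<close>

lemma path_on_intervalE:
  fixes p :: "real \<Rightarrow> 'b::real_normed_vector" and a b :: real
  assumes "path p" "a < b"
  obtains h where "continuous_on {a..b} h" "h a = pathstart p" "h b = pathfinish p"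
    "h ` {a..b} \<subseteq> path_image p"
proof
  let ?h = "\<lambda>s. p ((s - a) / (b - a))"
  have unit: "(s - a) / (b - a) \<in> {0..1}" if "s \<in> {a..b}" for s
    using that \<open>a < b\<close> by auto
  have "continuous_on {0..1} p" using assms(1) by (simp add: path_def)
  then show "continuous_on {a..b} ?h"
    by (rule continuous_on_compose2) (use unit \<open>a < b\<close> in \<open>auto intro!: continuous_intros\<close>)
  show "?h ` {a..b} \<subseteq> path_image p" unfolding path_image_def using unit by auto
qed (use \<open>a < b\<close> in \<open>simp_all add: pathstart_def pathfinish_def\<close>)

locale inscribed_cubes =
  fixes Ob :: "(real ^ 'n::finite) set" and \<kappa> :: real
  assumes open_Ob: "open Ob" and Ob_ne_UNIV: "Ob \<noteq> UNIV"
    and \<kappa>_pos: "0 < \<kappa>" and \<kappa>_le: "\<kappa> * (8 * real CARD('n)) \<le> 1"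
begin

definition rad :: "real ^ 'n \<Rightarrow> real" where
  "rad x = \<kappa> * infdist x (- Ob)"

lemma rad_nonneg: "0 \<le> rad x"
  using \<kappa>_pos by (simp add: rad_def infdist_nonneg)

lemma rad_pos_iff: "0 < rad x \<longleftrightarrow> x \<in> Ob"
proof
  assume "x \<in> Ob"
  then show "0 < rad x"
    unfolding rad_def using \<kappa>_pos open_Ob Ob_ne_UNIV
    by (intro mult_pos_pos infdist_pos_not_in_closed) auto
next
  assume "0 < rad x"
  then show "x \<in> Ob" by (cases "x \<in> Ob") (simp_all add: rad_def)
qed

lemma continuous_on_rad: "continuous_on A rad"
  unfolding rad_def[abs_def] by (intro continuous_intros)

lemma borel_measurable_rad [measurable]: "rad \<in> borel_measurable borel"
  by (rule borel_measurable_continuous_onI[OF continuous_on_rad])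

lemma abs_rad_diff_le:
  assumes "y \<in> closed_cube x r"
  shows "\<bar>rad y - rad x\<bar> \<le> r / 8"
proof -
  have "0 \<le> r" using assms abs_ge_zero order_trans unfolding mem_closed_cube by blast
  have "\<bar>rad y - rad x\<bar> = \<kappa> * \<bar>infdist y (- Ob) - infdist x (- Ob)\<bar>"
    using \<kappa>_pos by (simp add: rad_def abs_mult flip: right_diff_distrib)
  also have "\<dots> \<le> \<kappa> * (real CARD('n) * r)"
    using \<kappa>_pos dist_closed_cube_le[OF assms] infdist_triangle_abs[of y "- Ob" x]
    by (intro mult_left_mono) auto
  also have "\<dots> = \<kappa> * (8 * real CARD('n)) * (r / 8)" by simp
  also have "\<dots> \<le> 1 * (r / 8)" using \<open>0 \<le> r\<close> by (intro mult_right_mono \<kappa>_le) auto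
  finally show ?thesis by simp
qed

lemma closed_cube_double_rad_subset:
  assumes "x \<in> Ob"
  shows "closed_cube x (2 * rad x) \<subseteq> Ob"
proof
  fix y assume "y \<in> closed_cube x (2 * rad x)"
  then have "\<bar>rad y - rad x\<bar> \<le> 2 * rad x / 8" by (rule abs_rad_diff_le)
  moreover have "0 < rad x" using assms by (simp add: rad_pos_iff)
  ultimately have "0 < rad y" by linarith
  then show "y \<in> Ob" by (simp add: rad_pos_iff)
qed

lemma closed_cube_rad_subset: "x \<in> Ob \<Longrightarrow> closed_cube x (rad x) \<subseteq> Ob"
  using closed_cube_mono[of "rad x" "2 * rad x" x] closed_cube_double_rad_subset[of x] rad_nonneg[of x]
  by auto

lemma sign_step_in_Ob:
  assumes "x \<in> Ob" "d \<in> sign_vectors"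
  shows "x + rad x *\<^sub>R d \<in> Ob"
  using closed_cube_rad_subset[OF assms(1)] sign_step_in_closed_cube[OF assms(2) rad_nonneg] by blast

lemma round_vec_rescaled_in_sign_vectors:
  assumes "x \<in> Ob" "y \<in> closed_cube x (rad x)"
  shows "round_vec ((y - x) /\<^sub>R rad x) \<in> sign_vectors"
proof (rule round_vec_in_sign_vectors)
  have "0 < rad x" using assms(1) by (simp add: rad_pos_iff)
  then show "\<bar>((y - x) /\<^sub>R rad x) $ i\<bar> \<le> 1" for i
    using assms(2) by (auto simp: mem_closed_cube abs_mult divide_simps)
qed

text \<open>Rounding brings the new centre within half an old radius of the exit point; the slack up to
  \<open>3/4\<close> absorbs the change of the radius.\<close>

lemma in_recentred_cube:
  assumes "x \<in> Ob" "y \<in> closed_cube x (rad x)"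
  defines "x' \<equiv> x + rad x *\<^sub>R round_vec ((y - x) /\<^sub>R rad x)"
  shows "y \<in> closed_cube x' (3/4 * rad x')"
  unfolding mem_closed_cube
proof
  fix i
  define z where "z = (y - x) /\<^sub>R rad x"
  have pos: "0 < rad x" using assms(1) by (simp add: rad_pos_iff)
  have "x' \<in> closed_cube x (rad x)"
    unfolding x'_def
    by (intro sign_step_in_closed_cube round_vec_rescaled_in_sign_vectors assms rad_nonneg)
  then have rad': "7/8 * rad x \<le> rad x'" using abs_rad_diff_le[of x' x "rad x"] by linarith
  have "y = x + rad x *\<^sub>R z" using pos by (simp add: z_def)
  then have "y $ i - x' $ i = rad x * (z $ i - round_vec z $ i)"
    unfolding x'_def z_def[symmetric] by (simp add: algebra_simps)
  then have "\<bar>y $ i - x' $ i\<bar> \<le> rad x * (1/2)"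
    using pos abs_diff_round_vec_le[of z i] by (simp add: abs_mult)
  then show "\<bar>y $ i - x' $ i\<bar> \<le> 3/4 * rad x'" using rad' pos by linarith
qed

definition corridor :: "real ^ 'n \<Rightarrow> real ^ 'n \<Rightarrow> (real ^ 'n) set" where
  "corridor x d = open_cube x (rad x) \<union> open_cube (x + rad x *\<^sub>R d) (rad x / 2)"

definition corridor_end :: "real ^ 'n \<Rightarrow> real ^ 'n \<Rightarrow> (real ^ 'n) set" where
  "corridor_end x d = (if d = 0 then UNIV else - closed_cube x (rad x))"

lemma open_corridor: "open (corridor x d)"
  by (simp add: corridor_def open_Un open_open_cube)

lemma open_corridor_end: "open (corridor_end x d)"
  by (simp add: corridor_end_def open_Compl closed_closed_cube)

lemma corridor_subset:
  assumes x: "x \<in> Ob" and d: "d \<in> sign_vectors"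
  shows "corridor x d \<subseteq> Ob"
proof -
  have pos: "0 < rad x" using x by (simp add: rad_pos_iff)
  have "y \<in> closed_cube x (2 * rad x)" if "y \<in> open_cube (x + rad x *\<^sub>R d) (rad x / 2)" for y
    unfolding mem_closed_cube
  proof
    fix i
    have "\<bar>rad x * d $ i\<bar> \<le> rad x"
      using sign_step_in_closed_cube[OF d rad_nonneg[of x], of x] by (simp add: mem_closed_cube)
    moreover have "\<bar>y $ i - (x $ i + rad x * d $ i)\<bar> < rad x / 2"
      using that by (simp add: mem_open_cube)
    ultimately show "\<bar>y $ i - x $ i\<bar> \<le> 2 * rad x" using pos by linarith
  qed
  moreover have "open_cube x (rad x) \<subseteq> closed_cube x (2 * rad x)"
    using open_cube_subset_closed_cube closed_cube_mono[of "rad x" "2 * rad x" x] pos by fastforce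
  ultimately show ?thesis
    unfolding corridor_def using closed_cube_double_rad_subset[OF x] by blast
qed

lemma ex_path_in_corridor:
  fixes a b :: real
  assumes "a < b" and x: "x \<in> Ob" and d: "d \<in> sign_vectors" and y: "y \<in> open_cube x (rad x)"
  obtains h :: "real \<Rightarrow> real ^ 'n" where "continuous_on {a..b} h" "h a = y"
    "h ` {a..b} \<subseteq> corridor x d" "h b \<in> corridor_end x d"
proof -
  let ?r = "rad x"
  define y1 where "y1 = x + (3/4 * ?r) *\<^sub>R d"
  define y2 where "y2 = x + (5/4 * ?r) *\<^sub>R d"
  define p where "p = linepath y y1 +++ linepath y1 y2"
  have r: "0 < ?r" using x by (simp add: rad_pos_iff)
  have y1: "y1 \<in> open_cube x ?r" "y1 \<in> open_cube (x + ?r *\<^sub>R d) (?r / 2)"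
    and y2: "y2 \<in> open_cube (x + ?r *\<^sub>R d) (?r / 2)"
    using sign_step_in_open_cube[OF d, of "3/4 * ?r" 0 ?r x]
      sign_step_in_open_cube[OF d, of "3/4 * ?r" ?r "?r / 2" x]
      sign_step_in_open_cube[OF d, of "5/4 * ?r" ?r "?r / 2" x] r
    by (simp_all add: y1_def y2_def)
  have p: "path p" "pathstart p = y" "pathfinish p = y2" by (simp_all add: p_def)
  obtain h where "continuous_on {a..b} h" "h a = y" "h b = y2" "h ` {a..b} \<subseteq> path_image p"
    using path_on_intervalE[OF p(1) \<open>a < b\<close>] p(2,3) by metis
  moreover have "path_image p \<subseteq> corridor x d"
  proof -
    have "path_image p = closed_segment y y1 \<union> closed_segment y1 y2"
      unfolding p_def by (subst path_image_join) auto
    also have "\<dots> \<subseteq> corridor x d"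
      unfolding corridor_def by (intro Un_mono closed_segment_subset y y1 y2 convex_open_cube)
    finally show ?thesis .
  qed
  moreover have "y2 \<in> corridor_end x d"
    using sign_step_notin_closed_cube[OF d, of ?r "5/4 * ?r" x] r by (auto simp: corridor_end_def y2_def)
  ultimately show ?thesis using that[of h] by auto
qed

end

section \<open>The walk of cube centres along a path\<close>

text \<open>Starting at \<open>-1\<close> makes the half-open intervals \<open>(time k, time (k + 1)]\<close> cover time \<open>0\<close> as well.\<close>

locale cube_walk = inscribed_cubes Ob \<kappa>
  for Ob :: "(real ^ 'n::finite) set" and \<kappa> :: real +
  fixes T :: real and g :: "real \<Rightarrow> real ^ 'n"
  assumes T_gt: "-1 < T" and cont_g: "continuous_on UNIV g" and g_in: "g t \<in> Ob"
begin

primrec walk :: "nat \<Rightarrow> real \<times> (real ^ 'n)" where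
  "walk 0 = (-1, g (-1))"
| "walk (Suc k) = (case walk k of (a, x) \<Rightarrow> let b = exit_time T g a (closed_cube x (rad x)) in
    (b, x + rad x *\<^sub>R (if b < T then round_vec ((g b - x) /\<^sub>R rad x) else 0)))"

definition time :: "nat \<Rightarrow> real" where
  "time k = fst (walk k)"

definition centre :: "nat \<Rightarrow> real ^ 'n" where
  "centre k = snd (walk k)"

definition displacement :: "nat \<Rightarrow> real ^ 'n" where
  "displacement k = (if time (Suc k) < T
    then round_vec ((g (time (Suc k)) - centre k) /\<^sub>R rad (centre k)) else 0)"

lemma time_0: "time 0 = -1" and centre_0: "centre 0 = g (-1)"
  by (simp_all add: time_def centre_def)

lemma time_Suc: "time (Suc k) = exit_time T g (time k) (closed_cube (centre k) (rad (centre k)))"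
  by (simp add: time_def centre_def Let_def split: prod.splits)

lemma centre_Suc: "centre (Suc k) = centre k + rad (centre k) *\<^sub>R displacement k"
  by (simp add: displacement_def time_Suc) (simp add: time_def centre_def Let_def split: prod.splits)

lemma time_le_T: "time k \<le> T"
  using T_gt exit_time_le by (cases k) (simp_all add: time_0 time_Suc)

lemma time_Suc_ge: "time k \<le> time (Suc k)"
  unfolding time_Suc by (rule exit_time_ge[OF time_le_T])

lemma path_in_closed_cube:
  assumes "time k < s" "s \<le> time (Suc k)"
  shows "g s \<in> closed_cube (centre k) (rad (centre k))"
  using assms unfolding time_Suc by (rule until_exit_time[OF cont_g closed_closed_cube])

lemma in_interior_cube:
  assumes "y \<in> closed_cube x (3/4 * rad x)" "x \<in> Ob"
  shows "y \<in> interior (closed_cube x (rad x))"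
  using assms closed_cube_subset_open_cube[of "3/4 * rad x" "rad x" x] rad_pos_iff[of x]
  by (auto simp: interior_closed_cube)

lemma centre_in_and_near:
  "centre k \<in> Ob \<and> (time k < T \<longrightarrow> g (time k) \<in> closed_cube (centre k) (3/4 * rad (centre k)))"
proof (induction k)
  case 0
  then show ?case using g_in by (simp add: time_0 centre_0 mem_closed_cube rad_nonneg)
next
  case (Suc k)
  let ?x = "centre k" and ?t = "time (Suc k)"
  show ?case
  proof (cases "?t < T")
    case True
    then have "g (time k) \<in> interior (closed_cube ?x (rad ?x))" "time k < T"
      using Suc time_Suc_ge[of k] in_interior_cube by auto
    then have "time k < ?t" unfolding time_Suc by (intro exit_time_gt cont_g) auto
    then have "g ?t \<in> closed_cube ?x (rad ?x)"
      by (rule path_in_closed_cube) simp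
    then show ?thesis
      using Suc True sign_step_in_Ob[of ?x "round_vec ((g ?t - ?x) /\<^sub>R rad ?x)"]
        round_vec_rescaled_in_sign_vectors[of ?x "g ?t"] in_recentred_cube[of ?x "g ?t"]
      by (simp add: centre_Suc displacement_def)
  qed (use Suc in \<open>simp add: centre_Suc displacement_def\<close>)
qed

lemma centre_in: "centre k \<in> Ob"
  using centre_in_and_near by blast

lemma rad_centre_pos: "0 < rad (centre k)"
  by (simp add: rad_pos_iff centre_in)

lemma path_at_time_near_centre: "time k < T \<Longrightarrow> g (time k) \<in> closed_cube (centre k) (3/4 * rad (centre k))"
  using centre_in_and_near by blast

lemma path_at_time_interior: "time k < T \<Longrightarrow> g (time k) \<in> interior (closed_cube (centre k) (rad (centre k)))"
  by (intro in_interior_cube path_at_time_near_centre centre_in)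

lemma time_Suc_gt: "time k < T \<Longrightarrow> time k < time (Suc k)"
  unfolding time_Suc by (intro exit_time_gt cont_g path_at_time_interior) auto

lemma path_at_exitE:
  assumes "time (Suc k) < T"
  obtains i where "\<bar>g (time (Suc k)) $ i - centre k $ i\<bar> = rad (centre k)"
proof (rule frontier_closed_cubeE)
  have "time k < time (Suc k)" using assms time_Suc_ge[of k] by (intro time_Suc_gt) linarith
  then show "g (time (Suc k)) \<in> frontier (closed_cube (centre k) (rad (centre k)))"
    using assms unfolding time_Suc by (intro at_exit_time_frontier cont_g closed_closed_cube)
qed

lemma displacement_in_sign_vectors: "displacement k \<in> sign_vectors"
proof (cases "time (Suc k) < T")
  case True
  then have "time k < time (Suc k)" using time_Suc_ge[of k] by (intro time_Suc_gt) linarith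
  then have "g (time (Suc k)) \<in> closed_cube (centre k) (rad (centre k))"
    by (intro path_in_closed_cube) simp_all
  then show ?thesis
    by (simp add: displacement_def round_vec_rescaled_in_sign_vectors centre_in zero_in_sign_vectors)
qed (simp add: displacement_def zero_in_sign_vectors)

lemma displacement_eq_0_iff: "displacement k = 0 \<longleftrightarrow> time (Suc k) = T"
proof (cases "time (Suc k) < T")
  case True
  obtain i where "\<bar>g (time (Suc k)) $ i - centre k $ i\<bar> = rad (centre k)"
    by (rule path_at_exitE[OF True])
  then have "\<bar>((g (time (Suc k)) - centre k) /\<^sub>R rad (centre k)) $ i\<bar> = 1"
    using rad_centre_pos[of k] by (simp add: abs_mult)
  from round_vec_nonzero[OF this] show ?thesis using True by (simp add: displacement_def)
qed (use time_le_T[of "Suc k"] in \<open>simp add: displacement_def\<close>)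

lemma displacement_absorbed_at_0: "displacement k = 0 \<Longrightarrow> displacement (Suc k) = 0"
  using time_Suc_ge[of "Suc k"] time_le_T[of "Suc (Suc k)"] by (simp add: displacement_eq_0_iff)

lemma time_less_T_iff: "time k < T \<longleftrightarrow> (\<forall>j<k. displacement j \<noteq> 0)"
proof (induction k)
  case (Suc k)
  have "time (Suc k) < T \<longleftrightarrow> time k < T \<and> time (Suc k) \<noteq> T"
    using time_Suc_ge[of k] time_le_T[of "Suc k"] by linarith
  then show ?case using Suc by (auto simp: displacement_eq_0_iff less_Suc_eq)
qed (simp add: time_0 T_gt)

lemma centre_Suc_in_closed_cube: "centre (Suc k) \<in> closed_cube (centre k) (rad (centre k))"
  unfolding centre_Suc by (rule sign_step_in_closed_cube[OF displacement_in_sign_vectors rad_nonneg])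

lemma rad_path_le_step:
  assumes "time (Suc k) < T"
  shows "rad (g (time k)) \<le> 8 * dist (g (time (Suc k))) (g (time k))"
proof -
  let ?x = "centre k" and ?y = "g (time k)" and ?z = "g (time (Suc k))"
  have near: "?y \<in> closed_cube ?x (3/4 * rad ?x)"
    using assms time_Suc_ge[of k] by (intro path_at_time_near_centre) linarith
  obtain i where "\<bar>?z $ i - ?x $ i\<bar> = rad ?x" by (rule path_at_exitE[OF assms])
  moreover have "\<bar>?y $ i - ?x $ i\<bar> \<le> 3/4 * rad ?x" using near by (simp add: mem_closed_cube)
  moreover have "\<bar>?z $ i - ?y $ i\<bar> \<le> dist ?z ?y"
    unfolding dist_norm using component_le_norm_cart[of "?z - ?y" i] by simp
  ultimately have "1/4 * rad ?x \<le> dist ?z ?y" by linarith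
  moreover have "\<bar>rad ?y - rad ?x\<bar> \<le> 3/4 * rad ?x / 8" by (rule abs_rad_diff_le[OF near])
  ultimately show ?thesis using rad_nonneg[of ?x] by linarith
qed

text \<open>If the exit times accumulated, the steps of the path between them would tend to zero, and hence so
  would the radii at a sequence of points converging in the open set.\<close>

lemma time_reaches_T: "\<exists>k. time k = T"
proof (rule ccontr)
  assume "\<nexists>k. time k = T"
  then have less: "time k < T" for k using time_le_T[of k] by (meson le_less)
  have "incseq time" by (intro incseq_SucI time_Suc_ge)
  then obtain l where l: "time \<longlonglongrightarrow> l" by (rule incseq_convergent) (use time_le_T in blast)
  have "isCont g l" using cont_g by (simp add: continuous_on_eq_continuous_at)
  then have g: "(\<lambda>k. g (time k)) \<longlonglongrightarrow> g l" by (rule isCont_tendsto_compose[OF _ l])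
  have "(\<lambda>k. rad (g (time k))) \<longlonglongrightarrow> rad (g l)"
    using continuous_on_rad[of UNIV]
    by (intro isCont_tendsto_compose[OF _ g]) (simp add: continuous_on_eq_continuous_at)
  moreover have "(\<lambda>k. 8 * dist (g (time (Suc k))) (g (time k))) \<longlonglongrightarrow> 8 * dist (g l) (g l)"
    by (intro tendsto_intros g LIMSEQ_Suc[OF g])
  ultimately have "rad (g l) \<le> 8 * dist (g l) (g l)"
    by (rule LIMSEQ_le) (use rad_path_le_step[OF less] in blast)
  then show False using rad_pos_iff[of "g l"] g_in[of l] by simp
qed

lemma displacement_reaches_0: "\<exists>k. displacement k = 0"
proof -
  obtain k where "time k = T" using time_reaches_T by blast
  then have "time (Suc k) = T" using time_Suc_ge[of k] time_le_T[of "Suc k"] by simp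
  then show ?thesis by (auto simp: displacement_eq_0_iff)
qed

lemma time_intervalE:
  assumes "-1 < t" "t \<le> T"
  obtains k where "time k < t" "t \<le> time (Suc k)"
proof -
  define m where "m = (LEAST j. t \<le> time j)"
  have m: "t \<le> time m"
    unfolding m_def using time_reaches_T assms(2) by (metis (mono_tags, lifting) LeastI)
  then obtain k where k: "m = Suc k" using assms(1) by (cases m) (auto simp: time_0)
  then have "\<not> t \<le> time k" using not_less_Least[of k "\<lambda>j. t \<le> time j"] m_def by simp
  then show ?thesis using that[of k] m k by simp
qed

lemma displacement_of_path_in_corridor:
  assumes d: "d \<in> sign_vectors" and q: "time k < q" "q \<le> time (Suc k)"
    and path: "\<And>s. s \<in> {q..T} \<Longrightarrow> g s \<in> corridor (centre k) d" and end_: "g T \<in> corridor_end (centre k) d"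
  shows "displacement k = d"
proof (cases "time (Suc k) < T")
  case True
  let ?x = "centre k" and ?y = "g (time (Suc k))" and ?r = "rad (centre k)"
  obtain i where "\<bar>?y $ i - ?x $ i\<bar> = ?r" by (rule path_at_exitE[OF True])
  then have "?y \<notin> open_cube ?x ?r" by (simp add: mem_open_cube) (metis less_irrefl)
  then have near: "?y \<in> open_cube (?x + ?r *\<^sub>R d) (?r / 2)"
    using path[of "time (Suc k)"] q True by (auto simp: corridor_def)
  have "round_vec ((?y - ?x) /\<^sub>R ?r) = d"
  proof (rule round_vec_eq_sign_vectorI[OF d])
    fix j
    have "((?y - ?x) /\<^sub>R ?r) $ j - d $ j = (?y $ j - (?x + ?r *\<^sub>R d) $ j) / ?r"
      using rad_centre_pos[of k] by (simp add: field_simps)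
    also have "\<bar>\<dots>\<bar> < 1 / 2"
      using near rad_centre_pos[of k] by (simp add: mem_open_cube pos_divide_less_eq)
    finally show "\<bar>((?y - ?x) /\<^sub>R ?r) $ j - d $ j\<bar> < 1 / 2" .
  qed
  then show ?thesis using True by (simp add: displacement_def)
next
  case False
  then have T: "time (Suc k) = T" using time_le_T[of "Suc k"] by simp
  have "g T \<in> closed_cube (centre k) (rad (centre k))"
    using path_in_closed_cube[of k T] q T by simp
  then have "d = 0" using end_ by (simp add: corridor_end_def split: if_splits)
  then show ?thesis using T by (simp add: displacement_eq_0_iff)
qed

end

section \<open>Reweighting the moves of an adapted sequence\<close>

locale move_reweighting = prob_space M
  for M :: "'a measure" +
  fixes H :: "nat \<Rightarrow> 'a measure" and D :: "'d set" and w :: "'d \<Rightarrow> real" and rest :: 'd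
    and move :: "nat \<Rightarrow> 'a \<Rightarrow> 'd"
  assumes subalgebra_H: "subalgebra M (H k)"
    and sets_H_Suc: "sets (H k) \<subseteq> sets (H (Suc k))"
    and finite_D: "finite D" and rest_in: "rest \<in> D"
    and w_pos: "d \<in> D \<Longrightarrow> 0 < w d" and sum_w: "(\<Sum>d\<in>D. w d) = 1"
    and move_adapted: "move k \<in> measurable (H (Suc k)) (count_space D)"
    and move_absorbed: "\<omega> \<in> space M \<Longrightarrow> move k \<omega> = rest \<Longrightarrow> move (Suc k) \<omega> = rest"
    and move_reaches_rest: "\<omega> \<in> space M \<Longrightarrow> \<exists>k. move k \<omega> = rest"
    and move_charged: "A \<in> sets (H k) \<Longrightarrow> (\<And>\<omega> j. \<omega> \<in> A \<Longrightarrow> j < k \<Longrightarrow> move j \<omega> \<noteq> rest) \<Longrightarrow>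
      emeasure M A \<noteq> 0 \<Longrightarrow> d \<in> D \<Longrightarrow> emeasure M (A \<inter> {\<omega> \<in> space M. move k \<omega> = d}) \<noteq> 0"
begin

lemma space_H [simp]: "space (H k) = space M"
  using subalgebra_H by (simp add: subalgebra_def)

lemma sets_H_M: "A \<in> sets (H k) \<Longrightarrow> A \<in> sets M"
  using subalgebra_H by (auto simp: subalgebra_def)

lemma measurable_H_M: "f \<in> measurable (H k) N \<Longrightarrow> f \<in> measurable M N"
  by (rule measurable_from_subalg[OF subalgebra_H])

lemma measurable_H_Suc: "f \<in> measurable (H k) N \<Longrightarrow> f \<in> measurable (H (Suc k)) N"
  using sets_H_Suc[of k] by (auto simp: measurable_def)

lemma sigma_finite_subalgebra_H: "sigma_finite_subalgebra M (H k)"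
proof -
  interpret finite_measure_subalgebra M "H k" by unfold_locales (rule subalgebra_H)
  show ?thesis by unfold_locales
qed

lemma move_in: "\<omega> \<in> space M \<Longrightarrow> move k \<omega> \<in> D"
  using measurable_space[OF move_adapted] by simp

lemma sets_move: "{\<omega> \<in> space M. move k \<omega> = d} \<in> sets (H (Suc k))"
proof (cases "d \<in> D")
  case True
  then show ?thesis
    using measurable_sets[OF move_adapted[of k], of "{d}"] by (simp add: vimage_def Int_def conj_commute)
next
  case False
  then have "{\<omega> \<in> space M. move k \<omega> = d} = {}" using move_in by blast
  then show ?thesis by (simp only: sets.empty_sets)
qed

lemma sets_move_M [measurable]: "{\<omega> \<in> space M. move k \<omega> = d} \<in> sets M"
  by (rule sets_H_M[OF sets_move])

definition active :: "nat \<Rightarrow> 'a set" where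
  "active k = {\<omega> \<in> space M. \<forall>j<k. move j \<omega> \<noteq> rest}"

lemma active_Suc: "active (Suc k) = active k - {\<omega> \<in> space M. move k \<omega> = rest}"
  by (auto simp: active_def less_Suc_eq)

lemma move_inactive: "\<omega> \<in> space M \<Longrightarrow> \<omega> \<notin> active k \<Longrightarrow> move k \<omega> = rest"
  by (induction k) (auto simp: active_Suc move_absorbed, simp add: active_def)

lemma sets_active [measurable]: "active k \<in> sets (H k)"
proof (induction k)
  case 0
  show ?case using sets.top[of "H 0"] by (simp add: active_def)
next
  case (Suc k)
  then show ?case using sets_move[of k rest] sets_H_Suc[of k] by (auto simp: active_Suc)
qed

lemma sets_active_M [measurable]: "active k \<in> sets M"
  by (rule sets_H_M[OF sets_active])

subsection \<open>Likelihood ratios\<close>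

definition move_prob :: "nat \<Rightarrow> 'd \<Rightarrow> 'a \<Rightarrow> ennreal" where
  "move_prob k d = nn_cond_exp M (H k) (indicator {\<omega> \<in> space M. move k \<omega> = d})"

lemma borel_measurable_move_prob [measurable]: "move_prob k d \<in> borel_measurable (H k)"
  by (simp add: move_prob_def)

lemma nn_integral_mult_move_prob:
  assumes "f \<in> borel_measurable (H k)"
  shows "(\<integral>\<^sup>+\<omega>. f \<omega> * move_prob k d \<omega> \<partial>M) = (\<integral>\<^sup>+\<omega>\<in>{\<omega> \<in> space M. move k \<omega> = d}. f \<omega> \<partial>M)"
proof -
  interpret sigma_finite_subalgebra M "H k" by (rule sigma_finite_subalgebra_H)
  show ?thesis unfolding move_prob_def by (rule nn_cond_exp_intg) (use assms in measurable)
qed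

lemma move_prob_nonzero:
  assumes d: "d \<in> D"
  shows "AE \<omega> in M. \<omega> \<in> active k \<longrightarrow> move_prob k d \<omega> \<noteq> 0"
proof -
  define A where "A = {\<omega> \<in> space (H k). \<omega> \<in> active k \<and> move_prob k d \<omega> = 0}"
  have A: "A \<in> sets (H k)" unfolding A_def by measurable
  have "emeasure M (A \<inter> {\<omega> \<in> space M. move k \<omega> = d})
      = (\<integral>\<^sup>+\<omega>\<in>{\<omega> \<in> space M. move k \<omega> = d}. indicator A \<omega> \<partial>M)"
    using sets_H_M[OF A] by (simp flip: indicator_inter_arith)
  also have "\<dots> = (\<integral>\<^sup>+\<omega>. indicator A \<omega> * move_prob k d \<omega> \<partial>M)"
    using A by (intro nn_integral_mult_move_prob[symmetric]) simp
  also have "\<dots> = (\<integral>\<^sup>+\<omega>. 0 \<partial>M)"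
    by (intro nn_integral_cong) (auto simp: A_def indicator_def)
  finally have "emeasure M (A \<inter> {\<omega> \<in> space M. move k \<omega> = d}) = 0" by simp
  then have "emeasure M A = 0"
    using move_charged[OF A _ _ d] by (auto simp: A_def active_def)
  then have "A \<in> null_sets M" using sets_H_M[OF A] by auto
  then show ?thesis by (rule AE_I') (auto simp: A_def active_def)
qed

lemma move_prob_finite: "AE \<omega> in M. move_prob k d \<omega> \<noteq> \<infinity>"
proof -
  have "(\<integral>\<^sup>+\<omega>. move_prob k d \<omega> \<partial>M) = emeasure M {\<omega> \<in> space M. move k \<omega> = d}"
    using nn_integral_mult_move_prob[of "\<lambda>_. 1" k d] by simp
  then show ?thesis
    using measurable_H_M[OF borel_measurable_move_prob] by (intro nn_integral_PInf_AE) auto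
qed

definition ratio :: "nat \<Rightarrow> 'a \<Rightarrow> ennreal" where
  "ratio k \<omega> = (if \<omega> \<in> active k then ennreal (w (move k \<omega>)) / move_prob k (move k \<omega>) \<omega> else 1)"

lemma borel_measurable_at_move:
  assumes "\<And>d. d \<in> D \<Longrightarrow> f d \<in> borel_measurable (H k)"
  shows "(\<lambda>\<omega>. f (move k \<omega>) \<omega>) \<in> borel_measurable (H (Suc k))"
  by (rule measurable_compose_countable'[OF measurable_H_Suc[OF assms] move_adapted
        countable_finite[OF finite_D]])

lemma borel_measurable_ratio: "ratio k \<in> borel_measurable (H (Suc k))"
proof -
  have "active k \<in> sets (H (Suc k))" using sets_active[of k] sets_H_Suc[of k] by blast
  then show ?thesis
    unfolding ratio_def[abs_def]
    by (intro measurable_If_set borel_measurable_at_move) simp_all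
qed

lemma nn_integral_move_ratio:
  assumes d: "d \<in> D" and f: "f \<in> borel_measurable (H k)"
  shows "(\<integral>\<^sup>+\<omega>\<in>{\<omega> \<in> space M. move k \<omega> = d}.
      ennreal (w d) / move_prob k d \<omega> * f \<omega> * indicator (active k) \<omega> \<partial>M)
    = (\<integral>\<^sup>+\<omega>\<in>active k. ennreal (w d) * f \<omega> \<partial>M)"
proof -
  let ?g = "\<lambda>\<omega>. ennreal (w d) / move_prob k d \<omega> * f \<omega> * indicator (active k) \<omega>"
  note [measurable] = f
  have "(\<integral>\<^sup>+\<omega>\<in>{\<omega> \<in> space M. move k \<omega> = d}. ?g \<omega> \<partial>M) = (\<integral>\<^sup>+\<omega>. ?g \<omega> * move_prob k d \<omega> \<partial>M)"
    by (rule nn_integral_mult_move_prob[symmetric]) measurable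
  also have "\<dots> = (\<integral>\<^sup>+\<omega>\<in>active k. ennreal (w d) * f \<omega> \<partial>M)"
  proof (rule nn_integral_cong_AE)
    show "AE \<omega> in M. ?g \<omega> * move_prob k d \<omega> = ennreal (w d) * f \<omega> * indicator (active k) \<omega>"
      using move_prob_nonzero[OF d, of k] move_prob_finite[of k d]
    proof eventually_elim
      case (elim \<omega>)
      show ?case
      proof (cases "\<omega> \<in> active k")
        case True
        then have "ennreal (w d) / move_prob k d \<omega> * move_prob k d \<omega> = ennreal (w d)"
          using elim by (simp add: ennreal_divide_times ennreal_divide_self less_top)
        then show ?thesis using True by (simp add: mult.commute mult.left_commute)
      qed simp
    qed
  qed
  finally show ?thesis .
qed

lemma nn_integral_active_ratio:
  assumes G: "\<And>d. d \<in> D \<Longrightarrow> G d \<in> borel_measurable (H k)"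
  shows "(\<integral>\<^sup>+\<omega>\<in>active k. ratio k \<omega> * G (move k \<omega>) \<omega> \<partial>M)
    = (\<integral>\<^sup>+\<omega>\<in>active k. (\<Sum>d\<in>D. ennreal (w d) * G d \<omega>) \<partial>M)"
proof -
  note [measurable] = measurable_H_M[OF G] measurable_H_M[OF borel_measurable_move_prob]
  let ?f = "\<lambda>d \<omega>. ennreal (w d) / move_prob k d \<omega> * G d \<omega> * indicator (active k) \<omega>"
  have "(\<integral>\<^sup>+\<omega>\<in>active k. ratio k \<omega> * G (move k \<omega>) \<omega> \<partial>M)
      = (\<integral>\<^sup>+\<omega>. (\<Sum>d\<in>D. ?f d \<omega> * indicator {\<omega> \<in> space M. move k \<omega> = d} \<omega>) \<partial>M)"
  proof (rule nn_integral_cong)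
    fix \<omega> assume \<omega>: "\<omega> \<in> space M"
    have "(\<Sum>d\<in>D. ?f d \<omega> * indicator {\<omega> \<in> space M. move k \<omega> = d} \<omega>)
        = (\<Sum>d\<in>D. if d = move k \<omega> then ?f (move k \<omega>) \<omega> else 0)"
      using \<omega> by (intro sum.cong) auto
    also have "\<dots> = ?f (move k \<omega>) \<omega>" using move_in[OF \<omega>] finite_D by simp
    finally show "ratio k \<omega> * G (move k \<omega>) \<omega> * indicator (active k) \<omega>
        = (\<Sum>d\<in>D. ?f d \<omega> * indicator {\<omega> \<in> space M. move k \<omega> = d} \<omega>)"
      by (simp add: ratio_def indicator_def)
  qed
  also have "\<dots> = (\<Sum>d\<in>D. \<integral>\<^sup>+\<omega>\<in>{\<omega> \<in> space M. move k \<omega> = d}. ?f d \<omega> \<partial>M)"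
    by (rule nn_integral_sum) measurable
  also have "\<dots> = (\<Sum>d\<in>D. \<integral>\<^sup>+\<omega>\<in>active k. ennreal (w d) * G d \<omega> \<partial>M)"
    by (intro sum.cong refl nn_integral_move_ratio G)
  also have "\<dots> = (\<integral>\<^sup>+\<omega>\<in>active k. (\<Sum>d\<in>D. ennreal (w d) * G d \<omega>) \<partial>M)"
    unfolding sum_distrib_right by (rule nn_integral_sum[symmetric]) measurable
  finally show ?thesis .
qed

primrec likelihood :: "nat \<Rightarrow> 'a \<Rightarrow> ennreal" where
  "likelihood 0 \<omega> = 1"
| "likelihood (Suc k) \<omega> = likelihood k \<omega> * ratio k \<omega>"

declare likelihood.simps(2) [simp del]

lemma borel_measurable_likelihood [measurable]: "likelihood k \<in> borel_measurable (H k)"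
proof (induction k)
  case 0
  show ?case by (simp add: likelihood.simps(1)[abs_def])
next
  case (Suc k)
  note [measurable] = measurable_H_Suc[OF Suc] borel_measurable_ratio
  show ?case unfolding likelihood.simps(2)[abs_def] by measurable
qed

lemma borel_measurable_likelihood_M [measurable]: "likelihood k \<in> borel_measurable M"
  by (rule measurable_H_M[OF borel_measurable_likelihood])

subsection \<open>Fair processes\<close>

text \<open>The witness \<open>G\<close> records the value of \<open>Y\<close> after each possible next move, which makes fairness
  a pointwise condition.\<close>

definition fair :: "(nat \<Rightarrow> 'a \<Rightarrow> ennreal) \<Rightarrow> bool" where
  "fair Y \<longleftrightarrow> (\<exists>G. \<forall>k. (\<forall>d\<in>D. G k d \<in> borel_measurable (H k)) \<and>
    (\<forall>\<omega>\<in>space M. Y k \<omega> \<noteq> \<infinity> \<and> G k rest \<omega> = Y k \<omega> \<and> G k (move k \<omega>) \<omega> = Y (Suc k) \<omega> \<and>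
      (\<Sum>d\<in>D. ennreal (w d) * G k d \<omega>) = Y k \<omega>))"

lemma fairE:
  assumes "fair Y"
  obtains G where "\<And>k d. d \<in> D \<Longrightarrow> G k d \<in> borel_measurable (H k)"
    "\<And>k \<omega>. \<omega> \<in> space M \<Longrightarrow> Y k \<omega> \<noteq> \<infinity>"
    "\<And>k \<omega>. \<omega> \<in> space M \<Longrightarrow> G k rest \<omega> = Y k \<omega>"
    "\<And>k \<omega>. \<omega> \<in> space M \<Longrightarrow> G k (move k \<omega>) \<omega> = Y (Suc k) \<omega>"
    "\<And>k \<omega>. \<omega> \<in> space M \<Longrightarrow> (\<Sum>d\<in>D. ennreal (w d) * G k d \<omega>) = Y k \<omega>"
  using assms unfolding fair_def by (elim exE) (rule that, blast+)

lemma borel_measurable_fair: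
  assumes "fair Y"
  shows "Y k \<in> borel_measurable (H k)"
proof -
  from assms obtain G where G: "G k rest \<in> borel_measurable (H k)"
    and eq: "\<And>\<omega>. \<omega> \<in> space M \<Longrightarrow> G k rest \<omega> = Y k \<omega>"
    by (rule fairE) (use rest_in in blast)
  show ?thesis using G by (rule measurable_cong[THEN iffD1, rotated]) (simp add: eq)
qed

lemma fair_inactive:
  assumes "fair Y" "\<omega> \<in> space M" "\<omega> \<notin> active k"
  shows "Y (Suc k) \<omega> = Y k \<omega>"
  using assms(1) by (rule fairE) (metis assms(2,3) move_inactive)

lemma likelihood_inactive: "\<omega> \<notin> active k \<Longrightarrow> likelihood (Suc k) \<omega> = likelihood k \<omega>"
  by (simp add: likelihood.simps(2) ratio_def)

lemma fair_one: "fair (\<lambda>_ _. 1)"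
proof -
  have "(\<Sum>d\<in>D. ennreal (w d)) = 1" using sum_w w_pos by (simp add: sum_ennreal less_imp_le)
  then show ?thesis unfolding fair_def by (intro exI[of _ "\<lambda>_ _ _. 1"]) simp
qed

lemma nn_integral_likelihood_fair_Suc:
  assumes Y: "fair Y" and A: "A \<in> sets (H k)"
  shows "(\<integral>\<^sup>+\<omega>\<in>A. likelihood (Suc k) \<omega> * Y (Suc k) \<omega> \<partial>M) = (\<integral>\<^sup>+\<omega>\<in>A. likelihood k \<omega> * Y k \<omega> \<partial>M)"
proof -
  note [measurable] = sets_H_M[OF A] measurable_H_M[OF borel_measurable_fair[OF Y]]
  from Y obtain G where G: "\<And>d. d \<in> D \<Longrightarrow> G k d \<in> borel_measurable (H k)"
    and after_move: "\<And>\<omega>. \<omega> \<in> space M \<Longrightarrow> G k (move k \<omega>) \<omega> = Y (Suc k) \<omega>"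
    and mean: "\<And>\<omega>. \<omega> \<in> space M \<Longrightarrow> (\<Sum>d\<in>D. ennreal (w d) * G k d \<omega>) = Y k \<omega>"
    by (rule fairE) blast
  let ?Z = "\<lambda>j \<omega>. likelihood j \<omega> * Y j \<omega> * indicator A \<omega>"
  have split: "(\<integral>\<^sup>+\<omega>. ?Z j \<omega> \<partial>M)
      = (\<integral>\<^sup>+\<omega>\<in>active k. ?Z j \<omega> \<partial>M) + (\<integral>\<^sup>+\<omega>\<in>space M - active k. ?Z j \<omega> \<partial>M)" for j
    by (subst nn_integral_add[symmetric]) (auto intro!: nn_integral_cong simp: indicator_def)
  have "(\<integral>\<^sup>+\<omega>\<in>space M - active k. ?Z (Suc k) \<omega> \<partial>M) = (\<integral>\<^sup>+\<omega>\<in>space M - active k. ?Z k \<omega> \<partial>M)"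
    by (intro nn_integral_cong) (auto simp: indicator_def fair_inactive[OF Y] likelihood_inactive)
  moreover have "(\<integral>\<^sup>+\<omega>\<in>active k. ?Z (Suc k) \<omega> \<partial>M)
      = (\<integral>\<^sup>+\<omega>\<in>active k. ratio k \<omega> * (likelihood k \<omega> * indicator A \<omega> * G k (move k \<omega>) \<omega>) \<partial>M)"
    by (intro nn_integral_cong) (simp add: after_move likelihood.simps(2) mult_ac)
  moreover have "\<dots> = (\<integral>\<^sup>+\<omega>\<in>active k. (\<Sum>d\<in>D. ennreal (w d) * (likelihood k \<omega> * indicator A \<omega> * G k d \<omega>)) \<partial>M)"
    by (intro nn_integral_active_ratio borel_measurable_times_ennreal borel_measurable_indicator
        borel_measurable_likelihood G A)
  moreover have "\<dots> = (\<integral>\<^sup>+\<omega>\<in>active k. ?Z k \<omega> \<partial>M)"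
    by (intro nn_integral_cong) (simp add: mean[symmetric] sum_distrib_left sum_distrib_right mult_ac)
  ultimately show ?thesis unfolding split by simp
qed

lemma nn_integral_likelihood_fair:
  assumes Y: "fair Y" and A: "A \<in> sets (H m)" and "m \<le> k"
  shows "(\<integral>\<^sup>+\<omega>\<in>A. likelihood k \<omega> * Y k \<omega> \<partial>M) = (\<integral>\<^sup>+\<omega>\<in>A. likelihood m \<omega> * Y m \<omega> \<partial>M)"
  using \<open>m \<le> k\<close>
proof (induction rule: dec_induct)
  case (step k)
  have "sets (H m) \<subseteq> sets (H k)"
    using \<open>m \<le> k\<close> sets_H_Suc by (rule lift_Suc_mono_le[of "\<lambda>k. sets (H k)", rotated])
  then show ?case using nn_integral_likelihood_fair_Suc[OF Y, of A k] A step by auto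
qed simp

lemma w_rest_le_1: "w rest \<le> 1"
  using member_le_sum[OF rest_in, of w] w_pos finite_D sum_w by (simp add: less_imp_le)

lemma sum_moves_except_rest:
  assumes mean: "(\<Sum>d\<in>D. ennreal (w d) * h d) = h rest" and finite: "h rest \<noteq> \<infinity>"
  shows "(\<Sum>d\<in>D - {rest}. ennreal (w d) * h d) = ennreal (1 - w rest) * h rest"
proof -
  have "ennreal (w rest) * h rest + (\<Sum>d\<in>D - {rest}. ennreal (w d) * h d) = h rest"
    using mean by (simp add: sum.remove[OF finite_D rest_in])
  also have "\<dots> = ennreal (w rest) * h rest + ennreal (1 - w rest) * h rest"
    using w_rest_le_1 w_pos[OF rest_in] by (simp flip: distrib_right ennreal_plus)
  finally show ?thesis using finite by (simp add: ennreal_mult_eq_top_iff)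
qed

lemma nn_integral_active_likelihood_fair_Suc_le:
  assumes Y: "fair Y"
  shows "(\<integral>\<^sup>+\<omega>\<in>active (Suc k). likelihood (Suc k) \<omega> * Y (Suc k) \<omega> \<partial>M)
    \<le> ennreal (1 - w rest) * (\<integral>\<^sup>+\<omega>\<in>active k. likelihood k \<omega> * Y k \<omega> \<partial>M)"
proof -
  note [measurable] = measurable_H_M[OF borel_measurable_fair[OF Y]]
  from Y obtain G where G: "\<And>d. d \<in> D \<Longrightarrow> G k d \<in> borel_measurable (H k)"
    and finite: "\<And>\<omega>. \<omega> \<in> space M \<Longrightarrow> Y k \<omega> \<noteq> \<infinity>"
    and rest: "\<And>\<omega>. \<omega> \<in> space M \<Longrightarrow> G k rest \<omega> = Y k \<omega>"
    and after_move: "\<And>\<omega>. \<omega> \<in> space M \<Longrightarrow> G k (move k \<omega>) \<omega> = Y (Suc k) \<omega>"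
    and mean: "\<And>\<omega>. \<omega> \<in> space M \<Longrightarrow> (\<Sum>d\<in>D. ennreal (w d) * G k d \<omega>) = Y k \<omega>"
    by (rule fairE) blast
  define moved where "moved d \<omega> = (if d = rest then 0 else likelihood k \<omega> * G k d \<omega>)" for d \<omega>
  have "(\<integral>\<^sup>+\<omega>\<in>active (Suc k). likelihood (Suc k) \<omega> * Y (Suc k) \<omega> \<partial>M)
      = (\<integral>\<^sup>+\<omega>\<in>active k. ratio k \<omega> * moved (move k \<omega>) \<omega> \<partial>M)"
    by (intro nn_integral_cong)
      (auto simp: active_Suc indicator_def moved_def after_move likelihood.simps(2) mult_ac)
  also have "\<dots> = (\<integral>\<^sup>+\<omega>\<in>active k. (\<Sum>d\<in>D. ennreal (w d) * moved d \<omega>) \<partial>M)"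
    unfolding moved_def using G by (intro nn_integral_active_ratio) (auto intro: borel_measurable_times)
  also have "\<dots> \<le> (\<integral>\<^sup>+\<omega>. ennreal (1 - w rest) * (likelihood k \<omega> * Y k \<omega> * indicator (active k) \<omega>) \<partial>M)"
  proof (rule nn_integral_mono)
    fix \<omega> assume \<omega>: "\<omega> \<in> space M"
    have "(\<Sum>d\<in>D - {rest}. ennreal (w d) * G k d \<omega>) = ennreal (1 - w rest) * Y k \<omega>"
      using sum_moves_except_rest[of "\<lambda>d. G k d \<omega>"] mean[OF \<omega>] finite[OF \<omega>] rest[OF \<omega>] by simp
    moreover have "(\<Sum>d\<in>D. ennreal (w d) * moved d \<omega>)
        = likelihood k \<omega> * (\<Sum>d\<in>D - {rest}. ennreal (w d) * G k d \<omega>)"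
      by (simp add: sum.remove[OF finite_D rest_in] moved_def sum_distrib_left mult_ac)
    ultimately show "(\<Sum>d\<in>D. ennreal (w d) * moved d \<omega>) * indicator (active k) \<omega>
        \<le> ennreal (1 - w rest) * (likelihood k \<omega> * Y k \<omega> * indicator (active k) \<omega>)"
      by (simp add: mult_ac)
  qed
  also have "\<dots> = ennreal (1 - w rest) * (\<integral>\<^sup>+\<omega>\<in>active k. likelihood k \<omega> * Y k \<omega> \<partial>M)"
    by (rule nn_integral_cmult) measurable
  finally show ?thesis .
qed

lemma nn_integral_Int_active_likelihood_fair_tendsto_0:
  assumes Y: "fair Y" and finite: "(\<integral>\<^sup>+\<omega>. Y 0 \<omega> \<partial>M) < \<infinity>"
  shows "(\<lambda>k. \<integral>\<^sup>+\<omega>\<in>A \<inter> active k. likelihood k \<omega> * Y k \<omega> \<partial>M) \<longlonglongrightarrow> 0"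
proof -
  let ?q = "1 - w rest" and ?N = "\<lambda>k. \<integral>\<^sup>+\<omega>\<in>active k. likelihood k \<omega> * Y k \<omega> \<partial>M"
  have q: "0 \<le> ?q" "?q < 1" using w_rest_le_1 w_pos[OF rest_in] by simp_all
  have "?N 0 \<le> (\<integral>\<^sup>+\<omega>. Y 0 \<omega> \<partial>M)" by (intro nn_integral_mono) (simp add: indicator_def)
  then obtain r where r: "r \<ge> 0" "?N 0 = ennreal r" using finite by (cases "?N 0") auto
  have bound: "?N k \<le> ennreal (?q ^ k * r)" for k
  proof (induction k)
    case 0
    show ?case using r(2) by simp
  next
    case (Suc k)
    have "?N (Suc k) \<le> ennreal ?q * ennreal (?q ^ k * r)"
      using nn_integral_active_likelihood_fair_Suc_le[OF Y] Suc
      by (meson mult_left_mono order_trans zero_le)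
    then show ?case using q r by (simp add: mult.assoc flip: ennreal_mult)
  qed
  have "(\<lambda>k. ennreal (?q ^ k * r)) \<longlonglongrightarrow> ennreal (0 * r)"
    using q by (intro tendsto_ennrealI tendsto_mult LIMSEQ_power_zero tendsto_const) simp
  then have lim: "(\<lambda>k. ennreal (?q ^ k * r)) \<longlonglongrightarrow> 0" by simp
  have "(\<integral>\<^sup>+\<omega>\<in>A \<inter> active k. likelihood k \<omega> * Y k \<omega> \<partial>M) \<le> ?N k" for k
    by (intro nn_integral_mono) (auto simp: indicator_def)
  then have "(\<integral>\<^sup>+\<omega>\<in>A \<inter> active k. likelihood k \<omega> * Y k \<omega> \<partial>M) \<le> ennreal (?q ^ k * r)" for k
    using bound by (rule order_trans)
  then show ?thesis by (intro tendsto_sandwich[OF _ _ tendsto_const lim] always_eventually) simp_all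
qed

subsection \<open>Terminal values\<close>

definition freeze :: "'a \<Rightarrow> nat" where
  "freeze \<omega> = (LEAST k. \<omega> \<notin> active k)"

definition terminal :: "(nat \<Rightarrow> 'a \<Rightarrow> 'b) \<Rightarrow> 'a \<Rightarrow> 'b" where
  "terminal Y \<omega> = Y (freeze \<omega>) \<omega>"

lemma measurable_terminal:
  assumes "\<And>k. Y k \<in> measurable M N"
  shows "terminal Y \<in> measurable M N"
proof -
  have "freeze \<in> measurable M (count_space UNIV)" unfolding freeze_def[abs_def] by measurable
  with assms show ?thesis unfolding terminal_def[abs_def] by (rule measurable_compose_countable)
qed

lemma inactive_mono: "\<omega> \<notin> active k \<Longrightarrow> k \<le> j \<Longrightarrow> \<omega> \<notin> active j"
  by (auto simp: active_def dest: less_le_trans)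

lemma ex_inactive: "\<exists>k. \<omega> \<notin> active k"
  using move_reaches_rest[of \<omega>] by (auto simp: active_def)

lemma inactive_freeze: "\<omega> \<notin> active (freeze \<omega>)"
  unfolding freeze_def by (rule LeastI_ex[OF ex_inactive])

lemma eq_terminal:
  assumes "\<And>j. \<omega> \<notin> active j \<Longrightarrow> Y (Suc j) \<omega> = Y j \<omega>" and "\<omega> \<notin> active k"
  shows "Y k \<omega> = terminal Y \<omega>"
proof -
  have "freeze \<omega> \<le> k" unfolding freeze_def by (rule Least_le) (rule assms(2))
  then show ?thesis
  proof (induction rule: dec_induct)
    case (step j)
    then show ?case using assms(1)[OF inactive_mono[OF inactive_freeze]] by simp
  qed (simp add: terminal_def)
qed

lemma nn_integral_terminal_inactive:
  assumes "fair Y"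
  shows "(\<integral>\<^sup>+\<omega>\<in>A - active k. terminal likelihood \<omega> * terminal Y \<omega> \<partial>M)
    = (\<integral>\<^sup>+\<omega>\<in>A - active k. likelihood k \<omega> * Y k \<omega> \<partial>M)"
  using eq_terminal[of _ likelihood k] eq_terminal[of _ Y k] likelihood_inactive fair_inactive[OF assms]
  by (intro nn_integral_cong) (auto simp: indicator_def)

lemma nn_integral_terminal:
  assumes Y: "fair Y" and finite: "(\<integral>\<^sup>+\<omega>. Y 0 \<omega> \<partial>M) < \<infinity>" and A: "A \<in> sets (H m)"
  shows "(\<integral>\<^sup>+\<omega>\<in>A. terminal likelihood \<omega> * terminal Y \<omega> \<partial>M) = (\<integral>\<^sup>+\<omega>\<in>A. likelihood m \<omega> * Y m \<omega> \<partial>M)"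
proof -
  have [measurable]: "A \<in> sets M" by (rule sets_H_M[OF A])
  have Y_M [measurable]: "Y k \<in> borel_measurable M" for k
    by (rule measurable_H_M[OF borel_measurable_fair[OF Y]])
  have [measurable]: "terminal likelihood \<in> borel_measurable M" "terminal Y \<in> borel_measurable M"
    by (intro measurable_terminal borel_measurable_likelihood_M Y_M)+
  define N where "N = density M (\<lambda>\<omega>. terminal likelihood \<omega> * terminal Y \<omega>)"
  define remainder where "remainder k = (\<integral>\<^sup>+\<omega>\<in>A \<inter> active k. likelihood k \<omega> * Y k \<omega> \<partial>M)" for k
  have "(\<Union>k. A - active k) = A" using ex_inactive by blast
  moreover have "(\<lambda>k. emeasure N (A - active k)) \<longlonglongrightarrow> emeasure N (\<Union>k. A - active k)"
    using inactive_mono[OF _ le_SucI[OF order_refl]]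
    by (intro Lim_emeasure_incseq incseq_SucI) (auto simp: N_def)
  moreover have "remainder \<longlonglongrightarrow> 0"
    unfolding remainder_def by (rule nn_integral_Int_active_likelihood_fair_tendsto_0[OF Y finite])
  ultimately have "(\<lambda>k. emeasure N (A - active k) + remainder k) \<longlonglongrightarrow> emeasure N A + 0"
    by (intro tendsto_add) simp_all
  then have lim: "(\<lambda>k. emeasure N (A - active k) + remainder k) \<longlonglongrightarrow> emeasure N A" by simp
  have split: "emeasure N (A - active k) + remainder k = (\<integral>\<^sup>+\<omega>\<in>A. likelihood k \<omega> * Y k \<omega> \<partial>M)" for k
  proof -
    have "emeasure N (A - active k)
        = (\<integral>\<^sup>+\<omega>\<in>A - active k. terminal likelihood \<omega> * terminal Y \<omega> \<partial>M)"
      unfolding N_def by (rule emeasure_density) measurable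
    also have "\<dots> = (\<integral>\<^sup>+\<omega>\<in>A - active k. likelihood k \<omega> * Y k \<omega> \<partial>M)"
      by (rule nn_integral_terminal_inactive[OF Y])
    finally show ?thesis
      unfolding remainder_def
      by (simp add: nn_integral_add[symmetric])
        (auto intro!: nn_integral_cong simp: indicator_def)
  qed
  have "(\<lambda>k. emeasure N (A - active k) + remainder k) \<longlonglongrightarrow> (\<integral>\<^sup>+\<omega>\<in>A. likelihood m \<omega> * Y m \<omega> \<partial>M)"
    by (intro tendsto_eventually eventually_sequentiallyI[of m])
      (rule trans[OF split nn_integral_likelihood_fair[OF Y A]])
  then have "(\<integral>\<^sup>+\<omega>\<in>A. likelihood m \<omega> * Y m \<omega> \<partial>M) = emeasure N A" using lim by (rule LIMSEQ_unique)
  also have "\<dots> = (\<integral>\<^sup>+\<omega>\<in>A. terminal likelihood \<omega> * terminal Y \<omega> \<partial>M)"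
    unfolding N_def by (rule emeasure_density) measurable
  finally show ?thesis by simp
qed

lemma terminal_likelihood_nonzero: "AE \<omega> in M. terminal likelihood \<omega> \<noteq> 0"
proof -
  have "AE \<omega> in M. \<forall>k. \<forall>d\<in>D. move_prob k d \<omega> \<noteq> \<infinity>"
    unfolding AE_all_countable by (intro allI AE_finite_allI finite_D move_prob_finite)
  moreover have "AE \<omega> in M. \<omega> \<in> space M" by (rule AE_space)
  ultimately show ?thesis
  proof eventually_elim
    case (elim \<omega>)
    have "ratio k \<omega> \<noteq> 0" for k
      using elim(1) move_in[OF elim(2), of k] w_pos[of "move k \<omega>"]
      by (auto simp: ratio_def ennreal_divide_eq_0_iff)
    then have "likelihood k \<omega> \<noteq> 0" for k
      by (induction k) (simp_all add: likelihood.simps(2))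
    then show ?case by (simp add: terminal_def)
  qed
qed

subsection \<open>The reweighted measure\<close>

definition reweighted :: "'a measure" where
  "reweighted = density M (terminal likelihood)"

lemma space_reweighted [simp]: "space reweighted = space M"
  and sets_reweighted [simp, measurable_cong]: "sets reweighted = sets M"
  by (simp_all add: reweighted_def)

lemma borel_measurable_terminal_likelihood [measurable]: "terminal likelihood \<in> borel_measurable M"
  by (intro measurable_terminal borel_measurable_likelihood_M)

lemma nn_integral_reweighted:
  "f \<in> borel_measurable M \<Longrightarrow> (\<integral>\<^sup>+\<omega>. f \<omega> \<partial>reweighted) = (\<integral>\<^sup>+\<omega>. terminal likelihood \<omega> * f \<omega> \<partial>M)"
  unfolding reweighted_def by (rule nn_integral_density) measurable

lemma subalgebra_reweighted_H: "subalgebra reweighted (H m)"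
  using subalgebra_H by (simp add: subalgebra_def)

lemma emeasure_reweighted_H:
  assumes A: "A \<in> sets (H m)"
  shows "emeasure reweighted A = emeasure (density M (likelihood m)) A"
proof -
  have [measurable]: "A \<in> sets M" by (rule sets_H_M[OF A])
  have "emeasure reweighted A = (\<integral>\<^sup>+\<omega>\<in>A. terminal likelihood \<omega> * terminal (\<lambda>_ _. 1) \<omega> \<partial>M)"
    unfolding reweighted_def by (simp add: emeasure_density terminal_def[of "\<lambda>_ _. 1"])
  also have "\<dots> = (\<integral>\<^sup>+\<omega>\<in>A. likelihood m \<omega> * 1 \<partial>M)"
    by (rule nn_integral_terminal[OF fair_one _ A]) (simp add: emeasure_space_1)
  finally show ?thesis by (simp add: emeasure_density)
qed

lemma nn_integral_reweighted_H:
  assumes f: "f \<in> borel_measurable (H m)"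
  shows "(\<integral>\<^sup>+\<omega>. f \<omega> \<partial>reweighted) = (\<integral>\<^sup>+\<omega>. likelihood m \<omega> * f \<omega> \<partial>M)"
proof -
  have sub: "subalgebra (density M (likelihood m)) (H m)"
    using subalgebra_H by (simp add: subalgebra_def)
  have "restr_to_subalg reweighted (H m) = restr_to_subalg (density M (likelihood m)) (H m)"
    by (rule measure_eqI)
      (simp_all add: sets_restr_to_subalg emeasure_restr_to_subalg subalgebra_reweighted_H sub
        emeasure_reweighted_H)
  then have "(\<integral>\<^sup>+\<omega>. f \<omega> \<partial>reweighted) = (\<integral>\<^sup>+\<omega>. f \<omega> \<partial>density M (likelihood m))"
    using nn_integral_subalgebra2[OF subalgebra_reweighted_H f] nn_integral_subalgebra2[OF sub f] by simp
  also have "\<dots> = (\<integral>\<^sup>+\<omega>. likelihood m \<omega> * f \<omega> \<partial>M)"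
    by (rule nn_integral_density) (simp_all add: measurable_H_M[OF f])
  finally show ?thesis .
qed

lemma nn_integral_reweighted_terminal:
  assumes Y: "fair Y" and finite: "(\<integral>\<^sup>+\<omega>. Y 0 \<omega> \<partial>M) < \<infinity>" and A: "A \<in> sets (H m)"
  shows "(\<integral>\<^sup>+\<omega>\<in>A. terminal Y \<omega> \<partial>reweighted) = (\<integral>\<^sup>+\<omega>\<in>A. Y m \<omega> \<partial>reweighted)"
proof -
  note [measurable] = sets_H_M[OF A]
  have [measurable]: "terminal Y \<in> borel_measurable M"
    by (intro measurable_terminal measurable_H_M[OF borel_measurable_fair[OF Y]])
  have "(\<integral>\<^sup>+\<omega>\<in>A. terminal Y \<omega> \<partial>reweighted) = (\<integral>\<^sup>+\<omega>\<in>A. terminal likelihood \<omega> * terminal Y \<omega> \<partial>M)"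
    by (subst nn_integral_reweighted) (simp_all add: mult.assoc)
  also have "\<dots> = (\<integral>\<^sup>+\<omega>\<in>A. likelihood m \<omega> * Y m \<omega> \<partial>M)" by (rule nn_integral_terminal[OF Y finite A])
  also have "\<dots> = (\<integral>\<^sup>+\<omega>\<in>A. Y m \<omega> \<partial>reweighted)"
    using A borel_measurable_fair[OF Y, of m]
    by (subst nn_integral_reweighted_H[of _ m]) (simp_all add: mult.assoc)
  finally show ?thesis .
qed

lemma nn_integral_reweighted_fair:
  assumes Y: "fair Y"
  shows "(\<integral>\<^sup>+\<omega>. Y m \<omega> \<partial>reweighted) = (\<integral>\<^sup>+\<omega>. Y 0 \<omega> \<partial>M)"
proof -
  have "(\<integral>\<^sup>+\<omega>. Y m \<omega> \<partial>reweighted) = (\<integral>\<^sup>+\<omega>\<in>space M. likelihood m \<omega> * Y m \<omega> \<partial>M)"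
    by (subst nn_integral_reweighted_H[OF borel_measurable_fair[OF Y]]) (auto intro!: nn_integral_cong)
  also have "\<dots> = (\<integral>\<^sup>+\<omega>\<in>space M. likelihood 0 \<omega> * Y 0 \<omega> \<partial>M)"
    using sets.top[of "H 0"] by (intro nn_integral_likelihood_fair[OF Y]) simp_all
  also have "\<dots> = (\<integral>\<^sup>+\<omega>. Y 0 \<omega> \<partial>M)" by (intro nn_integral_cong) simp
  finally show ?thesis .
qed

lemma prob_space_reweighted: "prob_space reweighted"
proof
  show "emeasure reweighted (space reweighted) = 1"
    using nn_integral_reweighted_fair[OF fair_one] by (simp add: emeasure_space_1)
qed

lemma AE_reweighted_iff: "(AE \<omega> in reweighted. P \<omega>) \<longleftrightarrow> (AE \<omega> in M. P \<omega>)"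
proof -
  have "(AE \<omega> in reweighted. P \<omega>) \<longleftrightarrow> (AE \<omega> in M. 0 < terminal likelihood \<omega> \<longrightarrow> P \<omega>)"
    unfolding reweighted_def by (rule AE_density) measurable
  also have "\<dots> \<longleftrightarrow> (AE \<omega> in M. P \<omega>)"
  proof
    assume "AE \<omega> in M. 0 < terminal likelihood \<omega> \<longrightarrow> P \<omega>"
    with terminal_likelihood_nonzero show "AE \<omega> in M. P \<omega>"
      by eventually_elim (simp add: zero_less_iff_neq_zero)
  qed auto
  finally show ?thesis .
qed

lemma equiv_prob_reweighted: "equiv_prob M reweighted"
proof -
  have "A \<in> null_sets M \<longleftrightarrow> A \<in> null_sets reweighted" if "A \<in> sets M" for A
    using that by (simp add: AE_iff_null_sets AE_reweighted_iff)
  then show ?thesis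
    using prob_space_reweighted by (auto simp: equiv_prob_def null_sets_def)
qed

end

section \<open>Conditional full support\<close>

locale cfs_process = prob_space M + real_filtration "space M" F
  for M :: "'a measure" and F :: "real \<Rightarrow> 'a measure" +
  fixes T :: real and Ob :: "(real ^ 'n::finite) set" and S :: "real \<Rightarrow> 'a \<Rightarrow> real ^ 'n"
  assumes sets_F_M: "sets (F t) \<subseteq> sets M"
    and S_adapted: "S t \<in> borel_measurable (F t)"
    and S_cont: "\<omega> \<in> space M \<Longrightarrow> continuous_on UNIV (\<lambda>t. S t \<omega>)"
    and S_in: "\<omega> \<in> space M \<Longrightarrow> S t \<omega> \<in> Ob"
    and S_cfs: "cond_full_support M F T Ob S"
begin

lemma subalgebra_F: "subalgebra M (F t)"
  using sets_F_M by (simp add: subalgebra_def space_F)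

lemma borel_measurable_S [measurable]: "S t \<in> borel_measurable M"
  by (rule measurable_from_subalg[OF subalgebra_F S_adapted])

definition tube :: "real \<Rightarrow> (real ^ 'n) set \<Rightarrow> (real ^ 'n) set \<Rightarrow> (real \<Rightarrow> real ^ 'n) set" where
  "tube q W U = {g \<in> path_space T Ob. (\<forall>s\<in>{q..T}. g s \<in> W) \<and> g T \<in> U}"

lemma uniform_open_tube:
  assumes q: "0 \<le> q" "q \<le> T" and W: "open W" and U: "open U"
  shows "uniform_open T Ob (tube q W U)"
  unfolding uniform_open_def
proof (intro conjI ballI)
  show "tube q W U \<subseteq> path_space T Ob" by (auto simp: tube_def)
  fix g assume g: "g \<in> tube q W U"
  have "compact (g ` {q..T})"
    using g q by (intro compact_continuous_image)
      (auto simp: tube_def path_space_def intro: continuous_on_subset)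
  moreover have "g ` {q..T} \<subseteq> W" using g by (auto simp: tube_def)
  ultimately obtain e1 where e1: "e1 > 0" "(\<Union>x\<in>g ` {q..T}. ball x e1) \<subseteq> W"
    using compact_subset_open_imp_ball_epsilon_subset[OF _ W] by metis
  obtain e2 where e2: "e2 > 0" "ball (g T) e2 \<subseteq> U"
    using U g by (auto simp: tube_def elim: openE)
  show "\<exists>e>0. \<forall>h\<in>path_space T Ob. (\<forall>t\<in>{0..T}. dist (h t) (g t) < e) \<longrightarrow>
      (\<exists>g'\<in>tube q W U. \<forall>t\<in>{0..T}. g' t = h t)"
  proof (intro exI[of _ "min e1 e2"] conjI ballI impI)
    show "0 < min e1 e2" using e1 e2 by simp
    fix h assume h: "h \<in> path_space T Ob" and near: "\<forall>t\<in>{0..T}. dist (h t) (g t) < min e1 e2"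
    have "h s \<in> W" if "s \<in> {q..T}" for s
    proof -
      have "h s \<in> ball (g s) e1" using near that q by (auto simp: dist_commute)
      then show ?thesis using e1(2) that by blast
    qed
    moreover have "h T \<in> ball (g T) e2" using near q by (auto simp: dist_commute)
    ultimately have "h \<in> tube q W U" using h e2(2) by (auto simp: tube_def)
    then show "\<exists>g'\<in>tube q W U. \<forall>t\<in>{0..T}. g' t = h t" by blast
  qed
qed

lemma path_event_tube:
  assumes q: "0 \<le> q" "q \<le> T"
  shows "path_event M T S (tube q W U) = {\<omega> \<in> space M. (\<forall>s\<in>{q..T}. S s \<omega> \<in> W) \<and> S T \<omega> \<in> U}"
proof (intro equalityI subsetI)
  fix \<omega> assume "\<omega> \<in> path_event M T S (tube q W U)"
  then obtain g where "\<omega> \<in> space M" "g \<in> tube q W U" "\<And>t. t \<in> {0..T} \<Longrightarrow> g t = S t \<omega>"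
    by (auto simp: path_event_def)
  then show "\<omega> \<in> {\<omega> \<in> space M. (\<forall>s\<in>{q..T}. S s \<omega> \<in> W) \<and> S T \<omega> \<in> U}"
    using q by (auto simp: tube_def)
next
  fix \<omega> assume "\<omega> \<in> {\<omega> \<in> space M. (\<forall>s\<in>{q..T}. S s \<omega> \<in> W) \<and> S T \<omega> \<in> U}"
  then have \<omega>: "\<omega> \<in> space M" "\<forall>s\<in>{q..T}. S s \<omega> \<in> W" "S T \<omega> \<in> U" by blast+
  then have "(\<lambda>t. S t \<omega>) \<in> tube q W U"
    using continuous_on_subset[OF S_cont[OF \<omega>(1)]] S_in[OF \<omega>(1)]
    by (auto simp: tube_def path_space_def)
  with \<omega>(1) show "\<omega> \<in> path_event M T S (tube q W U)"
    unfolding path_event_def mem_Collect_eq by (intro conjI bexI[of _ "\<lambda>t. S t \<omega>"] ballI refl)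
qed

lemma sets_path_event_tube:
  assumes q: "0 \<le> q" "q < T" and W: "open W" "W \<noteq> UNIV" and U: "open U"
  shows "path_event M T S (tube q W U) \<in> sets M"
proof -
  have "{\<omega> \<in> space M. \<forall>s\<in>{q..T}. S s \<omega> \<in> W} \<in> sets M"
    using q W by (intro sets_path_stays_in_open) (auto intro: continuous_on_subset[OF S_cont])
  moreover have "{\<omega> \<in> space M. S T \<omega> \<in> U} \<in> sets M"
    using borel_open[OF U] by measurable
  ultimately show ?thesis
    using q by (simp add: path_event_tube sets.sets_Collect_conj)
qed

lemma ex_path_in_tube_extending:
  assumes \<omega>: "\<omega> \<in> space M" and q: "0 \<le> q" "q \<le> T" and W: "W \<subseteq> Ob"
    and h: "continuous_on {q..T} h" "h q = S q \<omega>" "h ` {q..T} \<subseteq> W" "h T \<in> U"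
  shows "\<exists>g\<in>tube q W U. \<forall>s\<in>{0..q}. g s = S s \<omega>"
proof
  define g where "g s = (if s \<le> q then S s \<omega> else h s)" for s
  have on_tail: "g s = h s" if "s \<in> {q..T}" for s
    using that h(2) by (auto simp: g_def)
  have "continuous_on ({0..q} \<union> {q..T}) g"
    unfolding g_def
    by (rule continuous_on_cases)
      (use h in \<open>auto intro: continuous_on_subset[OF S_cont[OF \<omega>]]\<close>)
  moreover have "{0..q} \<union> {q..T} = {0..T}" using q by auto
  moreover have "g s \<in> Ob" if "s \<in> {0..T}" for s
  proof (cases "s \<le> q")
    case True
    then show ?thesis using S_in[OF \<omega>] by (simp add: g_def)
  next
    case False
    then have "h s \<in> W" using h(3) that by auto
    then show ?thesis using on_tail[of s] W that False by auto
  qed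
  ultimately show "g \<in> tube q W U"
    using on_tail h(3,4) q by (auto simp: tube_def path_space_def)
  show "\<forall>s\<in>{0..q}. g s = S s \<omega>" by (simp add: g_def)
qed

lemma emeasure_Int_path_event_tube_nonzero:
  assumes q: "0 \<le> q" "q < T" and W: "open W" "W \<noteq> UNIV" "W \<subseteq> Ob" and U: "open U"
    and B: "B \<in> sets (F q)" "emeasure M B \<noteq> 0"
    and extend: "\<And>\<omega>. \<omega> \<in> B \<Longrightarrow>
      \<exists>h. continuous_on {q..T} h \<and> h q = S q \<omega> \<and> h ` {q..T} \<subseteq> W \<and> h T \<in> U"
  shows "emeasure M (B \<inter> path_event M T S (tube q W U)) \<noteq> 0"
proof -
  interpret Fq: finite_measure_subalgebra M "F q" by unfold_locales (rule subalgebra_F)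
  have "AE \<omega> in M. (\<exists>g\<in>tube q W U. \<forall>s\<in>{0..q}. g s = S s \<omega>) \<longrightarrow>
      0 < real_cond_exp M (F q) (indicator (path_event M T S (tube q W U))) \<omega>"
    using S_cfs uniform_open_tube[of q W U] q W(1) U by (simp add: cond_full_support_def)
  then have "AE \<omega> in M. \<omega> \<in> B \<longrightarrow>
      0 < real_cond_exp M (F q) (indicator (path_event M T S (tube q W U))) \<omega>"
  proof eventually_elim
    case (elim \<omega>)
    show ?case
    proof
      assume "\<omega> \<in> B"
      moreover have "\<omega> \<in> space M" using sets.sets_into_space[OF B(1)] \<open>\<omega> \<in> B\<close> space_F by blast
      ultimately have "\<exists>g\<in>tube q W U. \<forall>s\<in>{0..q}. g s = S s \<omega>"
        using extend q W(3) by (meson ex_path_in_tube_extending less_imp_le)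
      with elim show "0 < real_cond_exp M (F q) (indicator (path_event M T S (tube q W U))) \<omega>" by blast
    qed
  qed
  then show ?thesis
    by (intro Fq.emeasure_Int_nonzero_of_cond_exp_pos B sets_path_event_tube q W U)
qed

end

section \<open>The walk of cube centres of a process with conditional full support\<close>

locale cfs_walk = cfs_process M F T Ob S + inscribed_cubes Ob \<kappa>
  for M :: "'a measure" and F T and Ob :: "(real ^ 'n::finite) set" and S \<kappa> +
  fixes x0 :: "real ^ 'n"
  assumes T_pos: "0 < T"
    and right_continuous: "(\<Inter>s\<in>{t<..}. sets (F s)) \<subseteq> sets (F t)"
    and S_past: "t \<le> 0 \<Longrightarrow> \<omega> \<in> space M \<Longrightarrow> S t \<omega> = S 0 \<omega>"
    and S_start: "AE \<omega> in M. S 0 \<omega> = x0"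
    and Ob_pos: "x \<in> Ob \<Longrightarrow> 0 < x $ i"
begin

definition time :: "nat \<Rightarrow> 'a \<Rightarrow> real" where
  "time k \<omega> = cube_walk.time Ob \<kappa> T (\<lambda>t. S t \<omega>) k"

definition centre :: "nat \<Rightarrow> 'a \<Rightarrow> real ^ 'n" where
  "centre k \<omega> = cube_walk.centre Ob \<kappa> T (\<lambda>t. S t \<omega>) k"

definition displacement :: "nat \<Rightarrow> 'a \<Rightarrow> real ^ 'n" where
  "displacement k \<omega> = cube_walk.displacement Ob \<kappa> T (\<lambda>t. S t \<omega>) k"

lemma cube_walk_S: "\<omega> \<in> space M \<Longrightarrow> cube_walk Ob \<kappa> T (\<lambda>t. S t \<omega>)"
  using T_pos by unfold_locales (auto simp: S_cont S_in)

lemmas walk_defs = time_def centre_def displacement_def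

lemmas time_0 = cube_walk.time_0[OF cube_walk_S, folded walk_defs]
  and centre_0 = cube_walk.centre_0[OF cube_walk_S, folded walk_defs]
  and time_Suc = cube_walk.time_Suc[OF cube_walk_S, folded walk_defs]
  and centre_Suc = cube_walk.centre_Suc[OF cube_walk_S, folded walk_defs]
  and displacement_eq = cube_walk.displacement_def[OF cube_walk_S, folded walk_defs]
  and time_le_T = cube_walk.time_le_T[OF cube_walk_S, folded walk_defs]
  and time_Suc_ge = cube_walk.time_Suc_ge[OF cube_walk_S, folded walk_defs]
  and time_less_T_iff = cube_walk.time_less_T_iff[OF cube_walk_S, folded walk_defs]
  and time_intervalE = cube_walk.time_intervalE[OF cube_walk_S, folded walk_defs]
  and centre_in = cube_walk.centre_in[OF cube_walk_S, folded walk_defs]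
  and centre_Suc_in_closed_cube = cube_walk.centre_Suc_in_closed_cube[OF cube_walk_S, folded walk_defs]
  and S_in_closed_cube = cube_walk.path_in_closed_cube[OF cube_walk_S, folded walk_defs]
  and S_time_interior = cube_walk.path_at_time_interior[OF cube_walk_S, folded walk_defs]
  and displacement_in_sign_vectors = cube_walk.displacement_in_sign_vectors[OF cube_walk_S, folded walk_defs]
  and displacement_absorbed_at_0 = cube_walk.displacement_absorbed_at_0[OF cube_walk_S, folded walk_defs]
  and displacement_reaches_0 = cube_walk.displacement_reaches_0[OF cube_walk_S, folded walk_defs]
  and displacement_of_S_in_corridor =
    cube_walk.displacement_of_path_in_corridor[OF cube_walk_S, folded walk_defs]

primrec reachable :: "nat \<Rightarrow> (real ^ 'n) set" where
  "reachable 0 = {x0}"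
| "reachable (Suc k) = (\<lambda>(x, d). x + rad x *\<^sub>R d) ` (reachable k \<times> sign_vectors)"

lemma finite_reachable: "finite (reachable k)"
  by (induction k) (simp_all add: finite_sign_vectors)

lemma AE_centre_reachable: "AE \<omega> in M. \<forall>k. centre k \<omega> \<in> reachable k"
proof -
  have "AE \<omega> in M. \<omega> \<in> space M" by (rule AE_space)
  with S_start show ?thesis
  proof eventually_elim
    case (elim \<omega>)
    show ?case
    proof
      show "centre k \<omega> \<in> reachable k" for k
      proof (induction k)
        case 0
        show ?case using elim S_past[of "-1" \<omega>] by (simp add: centre_0)
      next
        case (Suc k)
        then show ?case
          using displacement_in_sign_vectors[OF elim(2), of k] centre_Suc[OF elim(2), of k] by force
      qed
    qed
  qed
qed

subsection \<open>Information at the exit times\<close>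

abbreviation past :: "nat \<Rightarrow> 'a measure" where
  "past k \<equiv> pre_sigma (time k)"

lemma stopping_time_Suc:
  assumes stop: "stopping_time F (time k)" and centre: "centre k \<in> borel_measurable (past k)"
  shows "stopping_time F (time (Suc k))"
proof (rule stopping_time_of_right_continuous[OF right_continuous])
  fix t
  define exited where "exited q =
    {\<omega> \<in> space M. time k \<omega> < q \<and> S q \<omega> \<notin> closed_cube (centre k \<omega>) (rad (centre k \<omega>))}" for q
  have exited: "exited q \<in> sets (F q)" for q
  proof -
    define x where "x \<omega> = (if time k \<omega> \<le> q then centre k \<omega> else 0)" for \<omega>
    have [measurable]: "x \<in> borel_measurable (F q)"
      unfolding x_def[abs_def] by (rule borel_measurable_pre_sigma_restrict[OF stop centre])
    have [measurable]: "S q \<in> borel_measurable (F q)" by (rule S_adapted)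
    have [measurable]: "Measurable.pred (F q) (\<lambda>\<omega>. time k \<omega> < q)"
      by (rule stopping_time_less_const[OF stop])
    have "exited q = {\<omega> \<in> space (F q). time k \<omega> < q \<and> \<not> (\<forall>i. \<bar>S q \<omega> $ i - x \<omega> $ i\<bar> \<le> rad (x \<omega>))}"
      by (auto simp: exited_def x_def mem_closed_cube space_F)
    also have "\<dots> \<in> sets (F q)" by measurable
    finally show ?thesis .
  qed
  have "{\<omega> \<in> space M. time (Suc k) \<omega> < t}
      = (if T < t then space M else \<Union>q\<in>\<rat> \<inter> {..<t}. exited q)"
    using exit_time_less_iff_Rats[OF S_cont closed_closed_cube]
    by (auto simp: time_Suc exited_def)
  also have "\<dots> \<in> sets (F t)"
  proof -
    have "(\<Union>q\<in>\<rat> \<inter> {..<t}. exited q) \<in> sets (F t)"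
    proof (intro sets.countable_UN'' countable_Int1 countable_rat)
      fix q assume "q \<in> \<rat> \<inter> {..<t}"
      then show "exited q \<in> sets (F t)" using exited[of q] sets_F_mono[of q t] by auto
    qed
    then show ?thesis using sets.top[of "F t"] by (simp add: space_F)
  qed
  finally show "{\<omega> \<in> space M. time (Suc k) \<omega> < t} \<in> sets (F t)" .
qed

lemma sets_past_Suc:
  assumes "stopping_time F (time k)" "stopping_time F (time (Suc k))"
  shows "sets (past k) \<subseteq> sets (past (Suc k))"
  using time_Suc_ge by (intro mono_pre_sigma assms)

lemma borel_measurable_displacement_past:
  assumes stop: "stopping_time F (time k)" "stopping_time F (time (Suc k))"
    and centre: "centre k \<in> borel_measurable (past k)"
  shows "displacement k \<in> borel_measurable (past (Suc k))"
proof -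
  have [measurable]: "centre k \<in> borel_measurable (past (Suc k))"
    using centre sets_past_Suc[OF stop] by (auto simp: measurable_def space_pre_sigma)
  have [measurable]: "time (Suc k) \<in> borel_measurable (past (Suc k))"
    by (rule measurable_stopping_time_pre_sigma[OF stop(2)])
  have [measurable]: "(\<lambda>\<omega>. S (time (Suc k) \<omega>) \<omega>) \<in> borel_measurable (past (Suc k))"
    by (rule borel_measurable_pre_sigma_at_stopping_time[OF stop(2) S_adapted S_cont])
  have "(\<lambda>\<omega>. if time (Suc k) \<omega> < T
      then round_vec ((S (time (Suc k) \<omega>) \<omega> - centre k \<omega>) /\<^sub>R rad (centre k \<omega>)) else 0)
    \<in> borel_measurable (past (Suc k))" by measurable
  then show ?thesis
    by (rule measurable_cong[THEN iffD1, rotated]) (simp add: displacement_eq space_pre_sigma)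
qed

lemma stopping_time_and_centre_measurable:
  "stopping_time F (time k) \<and> centre k \<in> borel_measurable (past k)"
proof (induction k)
  case 0
  have "stopping_time F (\<lambda>_. -1)" by (rule stopping_time_const)
  then have stop: "stopping_time F (time 0)"
    by (rule stopping_time_cong[THEN iffD1, rotated]) (simp add: time_0 space_F)
  have "(\<lambda>\<omega>. S (time 0 \<omega>) \<omega>) \<in> borel_measurable (past 0)"
    by (rule borel_measurable_pre_sigma_at_stopping_time[OF stop S_adapted S_cont])
  then have "centre 0 \<in> borel_measurable (past 0)"
    by (rule measurable_cong[THEN iffD1, rotated]) (simp add: time_0 centre_0 space_pre_sigma)
  with stop show ?case ..
next
  case (Suc k)
  then have stop: "stopping_time F (time k)" "stopping_time F (time (Suc k))"
    using stopping_time_Suc by blast+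
  note [measurable] = borel_measurable_displacement_past[OF stop conjunct2[OF Suc]]
  have [measurable]: "centre k \<in> borel_measurable (past (Suc k))"
    using Suc sets_past_Suc[OF stop] by (auto simp: measurable_def space_pre_sigma)
  have "(\<lambda>\<omega>. centre k \<omega> + rad (centre k \<omega>) *\<^sub>R displacement k \<omega>) \<in> borel_measurable (past (Suc k))"
    by measurable
  then have "centre (Suc k) \<in> borel_measurable (past (Suc k))"
    by (rule measurable_cong[THEN iffD1, rotated]) (simp add: centre_Suc space_pre_sigma)
  with stop(2) show ?case ..
qed

lemma stopping_time_time: "stopping_time F (time k)"
  and borel_measurable_centre [measurable]: "centre k \<in> borel_measurable (past k)"
  using stopping_time_and_centre_measurable by auto

lemma subalgebra_past: "subalgebra M (past k)"
  unfolding subalgebra_def space_pre_sigma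
proof (intro conjI subsetI refl)
  fix A assume A: "A \<in> sets (past k)"
  have "{\<omega> \<in> A. time k \<omega> \<le> T} = A"
    using sets.sets_into_space[OF A] time_le_T by (auto simp: space_pre_sigma)
  then show "A \<in> sets M"
    using sets_pre_sigmaD[OF stopping_time_time A, of T] sets_F_M[of T] by auto
qed

lemma sets_centre_eq: "{\<omega> \<in> space M. centre k \<omega> = x} \<in> sets (past k)"
proof -
  have "{\<omega> \<in> space (past k). centre k \<omega> = x} \<in> sets (past k)" by measurable
  then show ?thesis by (simp add: space_pre_sigma)
qed

subsection \<open>Every displacement is charged\<close>

definition between_times :: "real \<Rightarrow> nat \<Rightarrow> real ^ 'n \<Rightarrow> 'a set" where
  "between_times t k x = {\<omega> \<in> space M. centre k \<omega> = x \<and> time k \<omega> < t \<and> t \<le> time (Suc k) \<omega>}"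

lemma sets_Int_between_times:
  assumes A: "A \<in> sets (past k)"
  shows "A \<inter> between_times t k x \<in> sets (F t)"
proof -
  let ?B = "{\<omega> \<in> A \<inter> {\<omega> \<in> space M. centre k \<omega> = x}. time k \<omega> < t}"
  have "?B \<in> sets (F t)"
    using A sets_centre_eq by (intro sets_pre_sigma_before[OF stopping_time_time]) auto
  moreover have "{\<omega> \<in> space (F t). \<not> time (Suc k) \<omega> < t} \<in> sets (F t)"
    using stopping_time_less_const[OF stopping_time_time] by measurable
  ultimately have "?B \<inter> {\<omega> \<in> space (F t). \<not> time (Suc k) \<omega> < t} \<in> sets (F t)" by blast
  also have "?B \<inter> {\<omega> \<in> space (F t). \<not> time (Suc k) \<omega> < t} = A \<inter> between_times t k x"
    by (auto simp: between_times_def space_F)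
  finally show ?thesis .
qed

definition inside_at :: "real \<Rightarrow> nat \<Rightarrow> real ^ 'n \<Rightarrow> 'a set" where
  "inside_at q k x = {\<omega> \<in> between_times q k x. S q \<omega> \<in> open_cube x (rad x)}"

lemma sets_Int_inside_at:
  assumes A: "A \<in> sets (past k)"
  shows "A \<inter> inside_at q k x \<in> sets (F q)"
proof -
  let ?C = "{\<omega> \<in> space (F q). S q \<omega> \<in> open_cube x (rad x)}"
  have "?C \<in> sets (F q)"
    using S_adapted[of q] borel_open[OF open_open_cube] by measurable
  then have "(A \<inter> between_times q k x) \<inter> ?C \<in> sets (F q)"
    using sets_Int_between_times[OF A] by blast
  also have "(A \<inter> between_times q k x) \<inter> ?C = A \<inter> inside_at q k x"
    by (auto simp: inside_at_def between_times_def space_F)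
  finally show ?thesis .
qed

lemma ex_rational_inside_at:
  assumes \<omega>: "\<omega> \<in> space M" and "time k \<omega> < T"
  obtains q where "q \<in> \<rat>" "0 < q" "q < T" "\<omega> \<in> inside_at q k (centre k \<omega>)"
proof -
  let ?u = "max (time k \<omega>) 0" and ?C = "closed_cube (centre k \<omega>) (rad (centre k \<omega>))"
  have S_before: "S s \<omega> = S (time k \<omega>) \<omega>" if "time k \<omega> \<le> s" "s \<le> ?u" for s
    using that S_past[OF _ \<omega>, of s] S_past[OF _ \<omega>, of "time k \<omega>"] by (cases "time k \<omega> < 0") auto
  have interior: "S (time k \<omega>) \<omega> \<in> interior ?C" by (rule S_time_interior[OF assms])
  have "?u < time (Suc k) \<omega>"
    unfolding time_Suc[OF \<omega>]
  proof (rule exit_time_gt[OF S_cont[OF \<omega>]])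
    show "S s \<omega> \<in> ?C" if "time k \<omega> < s" "s \<le> ?u" for s
      using S_before[of s] that interior interior_subset by auto
  qed (use S_before[of ?u] interior assms(2) T_pos in auto)
  moreover have "open ((\<lambda>t. S t \<omega>) -` interior ?C)"
    by (rule open_vimage[OF open_interior S_cont[OF \<omega>]])
  then obtain e where e: "e > 0" "ball ?u e \<subseteq> (\<lambda>t. S t \<omega>) -` interior ?C"
    using S_before[of ?u] interior by (auto elim: openE)
  ultimately obtain q where q: "q \<in> \<rat>" "?u < q" "q < min (?u + e) (time (Suc k) \<omega>)"
    using Rats_dense_in_real[of ?u "min (?u + e) (time (Suc k) \<omega>)"] by auto
  then have "q \<in> ball ?u e" by (simp add: dist_real_def)
  then have "\<omega> \<in> inside_at q k (centre k \<omega>)"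
    using e(2) q \<omega> by (auto simp: inside_at_def between_times_def interior_closed_cube)
  then show ?thesis using that[of q] q time_le_T[OF \<omega>, of "Suc k"] by simp
qed

lemma ex_charged_inside_at:
  assumes A: "A \<in> sets (past k)" "\<And>\<omega>. \<omega> \<in> A \<Longrightarrow> time k \<omega> < T" "emeasure M A \<noteq> 0"
  obtains q x where "0 < q" "q < T" "x \<in> Ob" "emeasure M (A \<inter> inside_at q k x) \<noteq> 0"
proof (rule ccontr)
  assume no_thesis: "\<not> thesis"
  note witness = that
  let ?I = "\<rat> \<inter> {0<..<T}" and ?X = "reachable k \<inter> Ob"
  have A_in_M: "A \<in> sets M" using A(1) subalgebra_past by (auto simp: subalgebra_def)
  have "AE \<omega> in M. \<omega> \<notin> A \<inter> inside_at q k x" if "q \<in> ?I" "x \<in> ?X" for q x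
  proof (rule AE_not_in)
    have "A \<inter> inside_at q k x \<in> sets M" using sets_Int_inside_at[OF A(1)] sets_F_M by blast
    then show "A \<inter> inside_at q k x \<in> null_sets M" 
      using witness[of q x] that no_thesis by auto
  qed
  moreover have "countable ?I" "countable ?X"
    using finite_reachable by (auto intro: countable_rat countable_finite)
  ultimately have "AE \<omega> in M. \<forall>q\<in>?I. \<forall>x\<in>?X. \<omega> \<notin> A \<inter> inside_at q k x"
    unfolding AE_ball_countable[OF \<open>countable ?I\<close>] AE_ball_countable[OF \<open>countable ?X\<close>] by blast
  with AE_centre_reachable AE_space[of M] have "AE \<omega> in M. \<omega> \<notin> A"
  proof eventually_elim
    case (elim \<omega>)
    show ?case
    proof
      assume \<omega>: "\<omega> \<in> A"
      obtain q where "q \<in> \<rat>" "0 < q" "q < T" "\<omega> \<in> inside_at q k (centre k \<omega>)"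
        by (rule ex_rational_inside_at[OF elim(2) A(2)[OF \<omega>]])
      then show False using elim \<omega> centre_in[OF elim(2), of k] by auto
    qed
  qed
  then have "A \<in> null_sets M" by (simp add: AE_iff_null_sets[OF A_in_M])
  then show False using A(3) by blast
qed

lemma borel_measurable_displacement [measurable]: "displacement k \<in> borel_measurable (past (Suc k))"
  by (intro borel_measurable_displacement_past stopping_time_time borel_measurable_centre)

lemma sets_displacement_eq: "{\<omega> \<in> space M. displacement k \<omega> = d} \<in> sets (past (Suc k))"
proof -
  have "{\<omega> \<in> space (past (Suc k)). displacement k \<omega> = d} \<in> sets (past (Suc k))" by measurable
  then show ?thesis by (simp add: space_pre_sigma)
qed

lemma displacement_charged:
  assumes d: "d \<in> sign_vectors"
    and A: "A \<in> sets (past k)" "\<And>\<omega>. \<omega> \<in> A \<Longrightarrow> time k \<omega> < T" "emeasure M A \<noteq> 0"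
  shows "emeasure M (A \<inter> {\<omega> \<in> space M. displacement k \<omega> = d}) \<noteq> 0"
proof -
  obtain q x where q: "0 < q" "q < T" and x: "x \<in> Ob" and B: "emeasure M (A \<inter> inside_at q k x) \<noteq> 0"
    using A by (rule ex_charged_inside_at)
  let ?E = "path_event M T S (tube q (corridor x d) (corridor_end x d))"
  have charged: "emeasure M (A \<inter> inside_at q k x \<inter> ?E) \<noteq> 0"
  proof (rule emeasure_Int_path_event_tube_nonzero)
    show "corridor x d \<noteq> UNIV" using corridor_subset[OF x d] Ob_ne_UNIV by auto
    fix \<omega> assume "\<omega> \<in> A \<inter> inside_at q k x"
    then have "S q \<omega> \<in> open_cube x (rad x)" by (simp add: inside_at_def)
    then show "\<exists>h. continuous_on {q..T} h \<and> h q = S q \<omega> \<and>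
        h ` {q..T} \<subseteq> corridor x d \<and> h T \<in> corridor_end x d"
      by (rule ex_path_in_corridor[OF q(2) x d]) blast
  qed (use q B sets_Int_inside_at[OF A(1)] in
      \<open>simp_all add: open_corridor open_corridor_end corridor_subset x d\<close>)
  moreover have "A \<inter> inside_at q k x \<inter> ?E \<subseteq> A \<inter> {\<omega> \<in> space M. displacement k \<omega> = d}"
  proof
    fix \<omega> assume "\<omega> \<in> A \<inter> inside_at q k x \<inter> ?E"
    then have "\<omega> \<in> A" "\<omega> \<in> space M" "centre k \<omega> = x" "time k \<omega> < q" "q \<le> time (Suc k) \<omega>"
      "\<And>s. s \<in> {q..T} \<Longrightarrow> S s \<omega> \<in> corridor x d" "S T \<omega> \<in> corridor_end x d"
      using q by (auto simp: path_event_tube inside_at_def between_times_def)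
    then show "\<omega> \<in> A \<inter> {\<omega> \<in> space M. displacement k \<omega> = d}"
      using displacement_of_S_in_corridor[of \<omega> d k q] d by blast
  qed
  moreover have "A \<inter> {\<omega> \<in> space M. displacement k \<omega> = d} \<in> sets M"
    using A(1) sets_displacement_eq[of k d] subalgebra_past by (auto simp: subalgebra_def)
  ultimately have "emeasure M (A \<inter> inside_at q k x \<inter> ?E)
      \<le> emeasure M (A \<inter> {\<omega> \<in> space M. displacement k \<omega> = d})"
    by (intro emeasure_mono)
  then show ?thesis using charged by auto
qed

subsection \<open>The martingale measure\<close>

sublocale reweighting: move_reweighting M past "sign_vectors :: (real ^ 'n) set"
  "\<lambda>_. 1 / real (card (sign_vectors :: (real ^ 'n) set))" 0 displacement
proof
  show "displacement k \<in> measurable (past (Suc k)) (count_space sign_vectors)" for k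
    unfolding measurable_count_space_eq2[OF finite_sign_vectors]
    using displacement_in_sign_vectors sets_displacement_eq
    by (auto simp: space_pre_sigma vimage_def Int_def conj_commute)
  show "emeasure M (A \<inter> {\<omega> \<in> space M. displacement k \<omega> = d}) \<noteq> 0"
    if A: "A \<in> sets (past k)" "\<And>\<omega> j. \<omega> \<in> A \<Longrightarrow> j < k \<Longrightarrow> displacement j \<omega> \<noteq> 0"
      "emeasure M A \<noteq> 0" and d: "d \<in> sign_vectors" for A k d
  proof (rule displacement_charged[OF d A(1) _ A(3)])
    fix \<omega> assume "\<omega> \<in> A"
    then show "time k \<omega> < T"
      using A(2) sets.sets_into_space[OF A(1)] time_less_T_iff[of \<omega> k] by (auto simp: space_pre_sigma)
  qed
qed (use card_sign_vectors_pos zero_in_sign_vectors subalgebra_past sets_past_Suc stopping_time_time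
    displacement_absorbed_at_0 displacement_reaches_0 in \<open>auto simp: finite_sign_vectors\<close>)

abbreviation Q :: "'a measure" where
  "Q \<equiv> reweighting.reweighted"

definition terminal_centre :: "'a \<Rightarrow> real ^ 'n" where
  "terminal_centre = reweighting.terminal centre"

lemma centre_pos: "\<omega> \<in> space M \<Longrightarrow> 0 < centre k \<omega> $ i"
  by (intro Ob_pos centre_in)

lemma terminal_centre_pos: "\<omega> \<in> space M \<Longrightarrow> 0 < terminal_centre \<omega> $ i"
  by (simp add: terminal_centre_def reweighting.terminal_def centre_pos)

lemma borel_measurable_terminal_centre [measurable]: "terminal_centre \<in> borel_measurable M"
  unfolding terminal_centre_def
  by (intro reweighting.measurable_terminal reweighting.measurable_H_M[OF borel_measurable_centre])

lemma fair_centre: "reweighting.fair (\<lambda>k \<omega>. ennreal (centre k \<omega> $ i))"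
  unfolding reweighting.fair_def
proof (intro exI[of _ "\<lambda>k d \<omega>. ennreal ((centre k \<omega> + rad (centre k \<omega>) *\<^sub>R d) $ i)"] allI conjI ballI)
  fix k \<omega> assume \<omega>: "\<omega> \<in> space M"
  let ?x = "centre k \<omega>" and ?c = "real (card (sign_vectors :: (real ^ 'n) set))"
  have pos: "0 < (?x + rad ?x *\<^sub>R d) $ i" if "d \<in> sign_vectors" for d
    by (intro Ob_pos sign_step_in_Ob centre_in \<omega> that)
  have "(\<Sum>d\<in>sign_vectors. ennreal (1 / ?c) * ennreal ((?x + rad ?x *\<^sub>R d) $ i))
      = (\<Sum>d\<in>sign_vectors. ennreal (1 / ?c * (?x + rad ?x *\<^sub>R d) $ i))"
    by (intro sum.cong refl ennreal_mult[symmetric] less_imp_le pos)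
      (simp_all add: card_sign_vectors_pos)
  also have "\<dots> = ennreal (\<Sum>d\<in>sign_vectors. 1 / ?c * (?x + rad ?x *\<^sub>R d) $ i)"
    by (intro sum_ennreal mult_nonneg_nonneg less_imp_le pos) (simp_all add: card_sign_vectors_pos)
  also have "(\<Sum>d\<in>sign_vectors. 1 / ?c * (?x + rad ?x *\<^sub>R d) $ i)
      = 1 / ?c * (\<Sum>d\<in>sign_vectors. ?x $ i + rad ?x * d $ i)"
    by (simp add: sum_distrib_left)
  also have "(\<Sum>d\<in>sign_vectors. ?x $ i + rad ?x * d $ i) = ?c * ?x $ i"
    by (simp add: sum.distrib sum_sign_vectors_nth flip: sum_distrib_left)
  also have "1 / ?c * (?c * ?x $ i) = ?x $ i"
    using card_sign_vectors_pos[where 'n = 'n] by simp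
  finally show "(\<Sum>d\<in>sign_vectors. ennreal (1 / ?c) * ennreal ((?x + rad ?x *\<^sub>R d) $ i)) = ennreal (?x $ i)" .
qed (auto simp: centre_Suc)

lemma nn_integral_centre_0_finite: "(\<integral>\<^sup>+\<omega>. ennreal (centre 0 \<omega> $ i) \<partial>M) < \<infinity>"
proof -
  have "AE \<omega> in M. ennreal (centre 0 \<omega> $ i) = ennreal (x0 $ i)"
    using AE_centre_reachable by eventually_elim (auto dest: spec[of _ 0])
  then have "(\<integral>\<^sup>+\<omega>. ennreal (centre 0 \<omega> $ i) \<partial>M) = (\<integral>\<^sup>+\<omega>. ennreal (x0 $ i) \<partial>M)"
    by (rule nn_integral_cong_AE)
  then show ?thesis by (simp add: emeasure_space_1)
qed

lemma integrable_centre: "integrable Q (\<lambda>\<omega>. centre k \<omega> $ i)"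
proof (rule integrableI_nonneg)
  show "(\<integral>\<^sup>+\<omega>. ennreal (centre k \<omega> $ i) \<partial>Q) < \<infinity>"
    using reweighting.nn_integral_reweighted_fair[OF fair_centre] nn_integral_centre_0_finite by simp
  show "(\<lambda>\<omega>. centre k \<omega> $ i) \<in> borel_measurable Q"
    using reweighting.measurable_H_M[OF borel_measurable_centre] by measurable
qed (auto intro!: AE_I2 less_imp_le centre_pos)

lemma nn_integral_terminal_centre:
  assumes "A \<in> sets (past k)"
  shows "(\<integral>\<^sup>+\<omega>\<in>A. ennreal (terminal_centre \<omega> $ i) \<partial>Q) = (\<integral>\<^sup>+\<omega>\<in>A. ennreal (centre k \<omega> $ i) \<partial>Q)"
  using reweighting.nn_integral_reweighted_terminal[OF fair_centre nn_integral_centre_0_finite assms]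
  by (simp add: terminal_centre_def reweighting.terminal_def)

lemma integrable_terminal_centre: "integrable Q (\<lambda>\<omega>. terminal_centre \<omega> $ i)"
proof (rule integrableI_nonneg)
  have "(\<integral>\<^sup>+\<omega>. ennreal (terminal_centre \<omega> $ i) \<partial>Q) = (\<integral>\<^sup>+\<omega>\<in>space M. ennreal (terminal_centre \<omega> $ i) \<partial>Q)"
    by (intro nn_integral_cong) simp
  also have "\<dots> = (\<integral>\<^sup>+\<omega>\<in>space M. ennreal (centre 0 \<omega> $ i) \<partial>Q)"
    using sets.top[of "past 0"] by (intro nn_integral_terminal_centre) (simp add: space_pre_sigma)
  also have "\<dots> = (\<integral>\<^sup>+\<omega>. ennreal (centre 0 \<omega> $ i) \<partial>Q)" by (intro nn_integral_cong) simp
  also have "\<dots> < \<infinity>"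
    using reweighting.nn_integral_reweighted_fair[OF fair_centre, of 0] nn_integral_centre_0_finite by simp
  finally show "(\<integral>\<^sup>+\<omega>. ennreal (terminal_centre \<omega> $ i) \<partial>Q) < \<infinity>" .
qed (auto intro!: AE_I2 less_imp_le terminal_centre_pos)

lemma integral_terminal_centre:
  assumes A: "A \<in> sets (past k)"
  shows "(\<integral>\<omega>. indicator A \<omega> * terminal_centre \<omega> $ i \<partial>Q) = (\<integral>\<omega>. indicator A \<omega> * centre k \<omega> $ i \<partial>Q)"
proof -
  have [measurable]: "A \<in> sets M" by (rule reweighting.sets_H_M[OF A])
  have [measurable]: "centre k \<in> borel_measurable M"
    by (rule reweighting.measurable_H_M[OF borel_measurable_centre])
  have eq: "(\<integral>\<omega>. indicator A \<omega> * y \<omega> $ i \<partial>Q) = enn2real (\<integral>\<^sup>+\<omega>\<in>A. ennreal (y \<omega> $ i) \<partial>Q)"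
    if [measurable]: "y \<in> borel_measurable M" and pos: "\<And>\<omega>. \<omega> \<in> space M \<Longrightarrow> 0 < y \<omega> $ i"
    for y :: "'a \<Rightarrow> real ^ 'n"
  proof -
    have "(\<integral>\<omega>. indicator A \<omega> * y \<omega> $ i \<partial>Q) = enn2real (\<integral>\<^sup>+\<omega>. ennreal (indicator A \<omega> * y \<omega> $ i) \<partial>Q)"
      using pos by (intro integral_eq_nn_integral AE_I2) (measurable, simp add: less_imp_le)
    also have "(\<integral>\<^sup>+\<omega>. ennreal (indicator A \<omega> * y \<omega> $ i) \<partial>Q) = (\<integral>\<^sup>+\<omega>\<in>A. ennreal (y \<omega> $ i) \<partial>Q)"
      by (intro nn_integral_cong) (simp add: indicator_def)
    finally show ?thesis .
  qed
  show ?thesis by (simp add: eq terminal_centre_pos centre_pos nn_integral_terminal_centre[OF A])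
qed

subsection \<open>The price system\<close>

definition price :: "real \<Rightarrow> 'a \<Rightarrow> real ^ 'n" where
  "price t \<omega> = (\<chi> i. real_cond_exp Q (F t) (\<lambda>\<omega>. terminal_centre \<omega> $ i) \<omega>)"

lemma borel_measurable_price: "price t \<in> borel_measurable (F t)"
  unfolding borel_measurable_vec_iff by (simp add: price_def)

lemma sigma_finite_subalgebra_Q: "sigma_finite_subalgebra Q (F t)"
proof -
  interpret Q: prob_space Q by (rule reweighting.prob_space_reweighted)
  interpret finite_measure_subalgebra Q "F t"
    by unfold_locales (use subalgebra_F in \<open>simp add: subalgebra_def\<close>)
  show ?thesis by unfold_locales
qed

lemma sets_between_times: "between_times t k x \<in> sets (F t)"
proof -
  have "space (past k) \<inter> between_times t k x \<in> sets (F t)" by (rule sets_Int_between_times[OF sets.top])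
  also have "space (past k) \<inter> between_times t k x = between_times t k x"
    by (auto simp: between_times_def space_pre_sigma)
  finally show ?thesis .
qed

lemma AE_price_in_closed_cube_on:
  "AE \<omega> in Q. \<omega> \<in> between_times t k x \<longrightarrow> price t \<omega> \<in> closed_cube x (rad x)"
proof -
  interpret Q: prob_space Q by (rule reweighting.prob_space_reweighted)
  interpret sigma_finite_subalgebra Q "F t" by (rule sigma_finite_subalgebra_Q)
  have "AE \<omega> in Q. \<omega> \<in> between_times t k x \<longrightarrow>
      x $ i - rad x \<le> price t \<omega> $ i \<and> price t \<omega> $ i \<le> x $ i + rad x" for i
    unfolding price_def vec_lambda_beta
  proof (rule real_cond_exp_between_on[OF integrable_terminal_centre integrable_centre sets_between_times])
    show "emeasure Q (between_times t k x) < \<infinity>" by (simp add: less_top[symmetric])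
    fix A assume "A \<in> sets (F t)" "A \<subseteq> between_times t k x"
    then have "A \<in> sets (past (Suc k))"
      by (intro sets_pre_sigma_of_after[OF stopping_time_time]) (auto simp: between_times_def)
    then show "(\<integral>\<omega>. indicator A \<omega> * terminal_centre \<omega> $ i \<partial>Q)
        = (\<integral>\<omega>. indicator A \<omega> * centre (Suc k) \<omega> $ i \<partial>Q)"
      by (rule integral_terminal_centre)
  next
    fix \<omega> assume "\<omega> \<in> between_times t k x"
    then have "centre (Suc k) \<omega> \<in> closed_cube x (rad x)"
      using centre_Suc_in_closed_cube by (auto simp: between_times_def)
    then have "\<bar>centre (Suc k) \<omega> $ i - x $ i\<bar> \<le> rad x" by (simp add: mem_closed_cube)
    then show "x $ i - rad x \<le> centre (Suc k) \<omega> $ i \<and> centre (Suc k) \<omega> $ i \<le> x $ i + rad x"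
      by linarith
  qed
  then have "AE \<omega> in Q. \<forall>i. \<omega> \<in> between_times t k x \<longrightarrow>
      x $ i - rad x \<le> price t \<omega> $ i \<and> price t \<omega> $ i \<le> x $ i + rad x"
    unfolding AE_all_countable by blast
  then show ?thesis
    by eventually_elim (simp add: mem_closed_cube abs_le_iff algebra_simps)
qed

lemma AE_price_and_S_in_closed_cube:
  assumes t: "t \<in> {0..T}"
  shows "AE \<omega> in Q. \<exists>x\<in>Ob. price t \<omega> \<in> closed_cube x (rad x) \<and> S t \<omega> \<in> closed_cube x (rad x)"
proof -
  have "AE \<omega> in Q. \<forall>k. \<forall>x\<in>reachable k. \<omega> \<in> between_times t k x \<longrightarrow> price t \<omega> \<in> closed_cube x (rad x)"
    unfolding AE_all_countable
    by (intro allI AE_finite_allI finite_reachable AE_price_in_closed_cube_on)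
  moreover have "AE \<omega> in Q. \<forall>k. centre k \<omega> \<in> reachable k"
    using AE_centre_reachable by (simp only: reweighting.AE_reweighted_iff)
  moreover have "AE \<omega> in Q. \<omega> \<in> space M" using AE_space[of Q] by simp
  ultimately show ?thesis
  proof eventually_elim
    case (elim \<omega>)
    obtain k where k: "time k \<omega> < t" "t \<le> time (Suc k) \<omega>"
      using time_intervalE[OF elim(3), of t] t by auto
    then have "price t \<omega> \<in> closed_cube (centre k \<omega>) (rad (centre k \<omega>))"
      using elim by (simp add: between_times_def)
    moreover have "S t \<omega> \<in> closed_cube (centre k \<omega>) (rad (centre k \<omega>))"
      by (rule S_in_closed_cube[OF elim(3) k])
    ultimately show ?case using centre_in[OF elim(3)] by blast
  qed
qed

lemma rad_le_nth:
  assumes "x \<in> Ob"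
  shows "rad x \<le> \<kappa> * x $ i"
proof -
  let ?y = "x - x $ i *\<^sub>R axis i 1"
  have "?y $ i = 0" by simp
  then have "?y \<in> - Ob" using Ob_pos[of ?y i] by fastforce
  then have "infdist x (- Ob) \<le> dist x ?y" by (rule infdist_le)
  also have "\<dots> = x $ i" using Ob_pos[OF assms, of i] by (simp add: dist_norm)
  finally show ?thesis using \<kappa>_pos by (simp add: rad_def)
qed

lemma nth_le_in_closed_cube:
  assumes x: "x \<in> Ob" and y: "y \<in> closed_cube x (rad x)" and z: "z \<in> closed_cube x (rad x)"
    and \<epsilon>: "0 < \<epsilon>" "\<kappa> * (2 + \<epsilon>) \<le> \<epsilon>"
  shows "y $ i \<le> (1 + \<epsilon>) * z $ i"
proof -
  have bounds: "\<bar>y $ i - x $ i\<bar> \<le> rad x" "\<bar>z $ i - x $ i\<bar> \<le> rad x"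
    using y z by (simp_all add: mem_closed_cube)
  have "y $ i \<le> x $ i + \<kappa> * x $ i" using bounds(1) rad_le_nth[OF x, of i] by linarith
  also have "\<dots> \<le> (1 + \<epsilon>) * (x $ i - \<kappa> * x $ i)"
    using mult_right_mono[OF \<epsilon>(2), of "x $ i"] Ob_pos[OF x, of i] by (simp add: algebra_simps)
  also have "\<dots> \<le> (1 + \<epsilon>) * z $ i"
    using bounds(2) rad_le_nth[OF x, of i] \<epsilon>(1) by (intro mult_left_mono) linarith+
  finally show ?thesis .
qed

definition consistent :: "real \<Rightarrow> real ^ 'n \<Rightarrow> real ^ 'n \<Rightarrow> bool" where
  "consistent \<epsilon> y s \<longleftrightarrow> y \<in> Ob \<and> (\<forall>i. 1 / (1 + \<epsilon>) \<le> y $ i / s $ i \<and> y $ i / s $ i \<le> 1 + \<epsilon>)"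

lemma consistent_in_closed_cube:
  assumes "x \<in> Ob" "y \<in> closed_cube x (rad x)" "z \<in> closed_cube x (rad x)" "0 < \<epsilon>" "\<kappa> * (2 + \<epsilon>) \<le> \<epsilon>"
  shows "consistent \<epsilon> y z"
proof -
  have "y \<in> Ob" "z \<in> Ob" using assms closed_cube_rad_subset by blast+
  moreover have "y $ i \<le> (1 + \<epsilon>) * z $ i" "z $ i \<le> (1 + \<epsilon>) * y $ i" for i
    using assms by (auto intro: nth_le_in_closed_cube)
  ultimately show ?thesis
    using Ob_pos assms(4) by (simp add: consistent_def divide_le_eq le_divide_eq mult.commute)
qed

lemma consistent_refl: "s \<in> Ob \<Longrightarrow> 0 < \<epsilon> \<Longrightarrow> consistent \<epsilon> s s"
  using Ob_pos[of s] by (auto simp: consistent_def less_imp_neq[symmetric])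

theorem ex_consistent_price_system:
  assumes \<epsilon>: "0 < \<epsilon>" "\<kappa> * (2 + \<epsilon>) \<le> \<epsilon>"
  shows "\<exists>St Q. eps_cps M F T \<epsilon> S St Q \<and> (\<forall>t\<in>{0..T}. \<forall>\<omega>\<in>space M. St t \<omega> \<in> Ob)"
proof -
  \<comment> \<open>For fixed \<open>t\<close> this changes the price only on a null set; it makes the bounds hold for all \<open>t\<close>
    simultaneously.\<close>
  define St where "St t \<omega> = (if consistent \<epsilon> (price t \<omega>) (S t \<omega>) then price t \<omega> else S t \<omega>)" for t \<omega>
  have consistent_St: "consistent \<epsilon> (St t \<omega>) (S t \<omega>)" if "\<omega> \<in> space M" for t \<omega>
    using consistent_refl[OF S_in[OF that] \<epsilon>(1)] by (simp add: St_def)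
  have "is_martingale Q F T St"
  proof (rule is_martingale_of_cond_exp[OF sigma_finite_subalgebra_Q sets_F_mono integrable_terminal_centre])
    fix t assume t: "t \<in> {0..T}"
    note [measurable] = borel_measurable_price[of t] S_adapted[of t] borel_open[OF open_Ob]
    show "St t \<in> borel_measurable (F t)" unfolding St_def[abs_def] consistent_def by measurable
    show "AE \<omega> in Q. St t \<omega> $ i = real_cond_exp Q (F t) (\<lambda>\<omega>. terminal_centre \<omega> $ i) \<omega>" for i
      using AE_price_and_S_in_closed_cube[OF t]
    proof eventually_elim
      case (elim \<omega>)
      then have "consistent \<epsilon> (price t \<omega>) (S t \<omega>)" using consistent_in_closed_cube \<epsilon> by blast
      then show ?case by (simp add: St_def price_def)
    qed
  qed
  then have "eps_cps M F T \<epsilon> S St Q"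
    using reweighting.equiv_prob_reweighted consistent_St by (auto simp: eps_cps_def consistent_def)
  then show ?thesis using consistent_St by (auto simp: consistent_def)
qed

end

section \<open>Open subsets of the positive orthant\<close>

lemma clamp_real: "a \<le> b \<Longrightarrow> clamp a b x = max a (min b x)" for x :: real
  unfolding clamp_def Basis_real_def by (auto simp: max_def min_def)

lemma cond_full_support_cong:
  assumes "\<And>t. t \<in> {0..T} \<Longrightarrow> F' t = F t" "\<And>t. t \<in> {0..T} \<Longrightarrow> S' t = S t"
  shows "cond_full_support M F' T Ob S' \<longleftrightarrow> cond_full_support M F T Ob S"
proof -
  have "path_event M T S' G = path_event M T S G" for G
    using assms(2) by (simp add: path_event_def)
  moreover have "(\<forall>s\<in>{0..t}. g s = S' s \<omega>) \<longleftrightarrow> (\<forall>s\<in>{0..t}. g s = S s \<omega>)" if "t \<in> {0..T}" for g t \<omega>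
    using assms(2) that by (intro ball_cong) auto
  ultimately show ?thesis
    unfolding cond_full_support_def using assms(1) by (intro ball_cong) simp_all
qed

lemma eps_cps_cong:
  assumes "\<And>t. t \<in> {0..T} \<Longrightarrow> F' t = F t" "\<And>t. t \<in> {0..T} \<Longrightarrow> S' t = S t"
  shows "eps_cps M F' T \<epsilon> S' St Q \<longleftrightarrow> eps_cps M F T \<epsilon> S St Q"
proof -
  have "is_martingale Q F' T St \<longleftrightarrow> is_martingale Q F T St"
    unfolding is_martingale_def using assms(1) by auto
  then show ?thesis using assms(2) by (simp add: eps_cps_def)
qed

context
  fixes M :: "'a measure" and F :: "real \<Rightarrow> 'a measure" and T :: real
  assumes T_pos: "0 < T" and usual: "usual_filtered_space M F T"
begin

interpretation prob_space M
  using usual by (simp add: usual_filtered_space_def)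

lemma subalgebra_usual: "t \<in> {0..T} \<Longrightarrow> subalgebra M (F t)"
  using usual by (simp add: usual_filtered_space_def)

lemma real_filtration_clamp: "real_filtration (space M) (\<lambda>t. F (clamp 0 T t))"
proof
  show "space (F (clamp 0 T t)) = space M" for t
    using subalgebra_usual[of "clamp 0 T t"] T_pos by (simp add: subalgebra_def clamp_real)
  show "sets (F (clamp 0 T s)) \<subseteq> sets (F (clamp 0 T t))" if "s \<le> t" for s t
  proof -
    have "0 \<le> clamp 0 T s" "clamp 0 T s \<le> clamp 0 T t" "clamp 0 T t \<le> T"
      using T_pos that by (auto simp: clamp_real)
    then show ?thesis using usual unfolding usual_filtered_space_def by blast
  qed
qed

lemma right_continuous_clamp: "(\<Inter>s\<in>{t<..}. sets (F (clamp 0 T s))) \<subseteq> sets (F (clamp 0 T t))"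
proof (cases "t \<in> {0..<T}")
  case True
  have "(\<Inter>s\<in>{t<..}. sets (F (clamp 0 T s))) \<subseteq> (\<Inter>s\<in>{t<..T}. sets (F s))"
  proof (rule INT_greatest)
    fix s assume "s \<in> {t<..T}"
    then show "(\<Inter>s\<in>{t<..}. sets (F (clamp 0 T s))) \<subseteq> sets (F s)"
      using True by (intro INF_lower2[of s]) (auto simp: clamp_real)
  qed
  also have "\<dots> = sets (F t)"
    using usual True unfolding usual_filtered_space_def by blast
  finally show ?thesis using True by (simp add: clamp_real)
next
  case False
  define s where "s = (if t < 0 then t / 2 else t + 1)"
  have "s \<in> {t<..}" "clamp 0 T s = clamp 0 T t" using False T_pos by (auto simp: s_def clamp_real)
  then show ?thesis by (intro INF_lower2[of s]) simp_all
qed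

lemma AE_constant_at_0:
  fixes f :: "'a \<Rightarrow> 'b::{second_countable_topology, t0_space}"
  assumes f: "f \<in> borel_measurable (F 0)"
  obtains c where "AE \<omega> in M. f \<omega> = c"
proof (rule AE_constant_of_trivial_preimages)
  have sub: "subalgebra M (F 0)" using subalgebra_usual T_pos by simp
  show "f \<in> borel_measurable M" by (rule measurable_from_subalg[OF sub f])
  fix U :: "'b set" assume "open U"
  then have [measurable]: "U \<in> sets borel" by simp
  note [measurable] = f
  have space: "space (F 0) = space M" using sub by (simp add: subalgebra_def)
  have "{\<omega> \<in> space (F 0). f \<omega> \<in> U} \<in> sets (F 0)" by measurable
  then have "{\<omega> \<in> space M. f \<omega> \<in> U} \<in> sets (F 0)" by (simp only: space)
  then show "prob {\<omega> \<in> space M. f \<omega> \<in> U} \<in> {0, 1}"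
    using usual unfolding usual_filtered_space_def by blast
qed

theorem ex_consistent_price_system_in_open:
  fixes Ob :: "(real ^ 'n::finite) set" and S :: "real \<Rightarrow> 'a \<Rightarrow> real ^ 'n"
  assumes open_Ob: "open Ob" and Ob_pos: "\<And>x i. x \<in> Ob \<Longrightarrow> 0 < x $ i"
    and S: "cont_adapted_process M F T Ob S" and cfs: "cond_full_support M F T Ob S" and \<epsilon>: "0 < \<epsilon>"
  shows "\<exists>St Q. eps_cps M F T \<epsilon> S St Q \<and> (\<forall>t\<in>{0..T}. \<forall>\<omega>\<in>space M. St t \<omega> \<in> Ob)"
proof -
  let ?F = "\<lambda>t. F (clamp 0 T t)" and ?S = "\<lambda>t. S (clamp 0 T t)"
  define \<kappa> where "\<kappa> = min (1 / (8 * real CARD('n))) (\<epsilon> / (2 + \<epsilon>))"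
  have clamp: "clamp 0 T t \<in> {0..T}" for t using T_pos by (simp add: clamp_real)
  have clamp_id: "clamp 0 T t = t" if "t \<in> {0..T}" for t using that by (simp add: clamp_real)
  obtain x0 where x0: "AE \<omega> in M. S 0 \<omega> = x0"
    using S T_pos AE_constant_at_0[of "S 0"] by (auto simp: cont_adapted_process_def)
  interpret real_filtration "space M" ?F by (rule real_filtration_clamp)
  interpret cfs_walk M ?F T Ob ?S \<kappa> x0
  proof
    show "sets (?F t) \<subseteq> sets M" for t
      using subalgebra_usual[OF clamp] by (auto simp: subalgebra_def)
    show "cond_full_support M ?F T Ob ?S"
      using cfs by (subst cond_full_support_cong[of T _ F _ S]) (simp_all add: clamp_id)
    show "continuous_on UNIV (\<lambda>t. ?S t \<omega>)" if "\<omega> \<in> space M" for \<omega>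
      using S that clamp_continuous_on[of 0 T "\<lambda>t. S t \<omega>"] by (simp add: cont_adapted_process_def)
    show "Ob \<noteq> UNIV" using Ob_pos[of 0 undefined] by auto
    show "\<kappa> * (8 * real CARD('n)) \<le> 1"
      by (simp add: \<kappa>_def min_def field_simps)
    show "?S t \<omega> = ?S 0 \<omega>" if "t \<le> 0" for t \<omega>
      using that T_pos by (simp add: clamp_real)
  qed (use S clamp open_Ob Ob_pos T_pos \<epsilon> x0 right_continuous_clamp in
      \<open>auto simp: cont_adapted_process_def \<kappa>_def clamp_real\<close>)
  have "\<kappa> * (2 + \<epsilon>) \<le> \<epsilon> / (2 + \<epsilon>) * (2 + \<epsilon>)"
    using \<epsilon> by (intro mult_right_mono) (simp_all add: \<kappa>_def)
  also have "\<dots> = \<epsilon>" using \<epsilon> by simp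
  finally have "\<kappa> * (2 + \<epsilon>) \<le> \<epsilon>" .
  from ex_consistent_price_system[OF \<epsilon> this] show ?thesis
    by (subst (asm) eps_cps_cong[of T _ F _ S]) (simp_all add: clamp_id)
qed

end

section \<open>The domain of the price process\<close>

lemma O_set_eq:
  "O_set \<delta> = {x :: real ^ 'n::finite. (\<forall>j. 0 < x $ j) \<and> (\<forall>j. x $ j < (1 - \<delta>) * (\<Sum>i\<in>UNIV. x $ i))}"
proof -
  have "Max (range (\<lambda>j. x $ j / (\<Sum>i\<in>UNIV. x $ i))) < 1 - \<delta> \<longleftrightarrow>
    (\<forall>j. x $ j < (1 - \<delta>) * (\<Sum>i\<in>UNIV. x $ i))" if "\<forall>j. 0 < x $ j" for x :: "real ^ 'n"
  proof -
    have "0 < (\<Sum>i\<in>UNIV. x $ i)" using that by (intro sum_pos) auto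
    then show ?thesis by (subst Max_less_iff) (auto simp: pos_divide_less_eq)
  qed
  then show ?thesis unfolding O_set_def by blast
qed

lemma open_O_set: "open (O_set \<delta> :: (real ^ 'n::finite) set)"
proof -
  have "O_set \<delta> = (\<Inter>j. {x :: real ^ 'n. 0 < x $ j} \<inter> {x. x $ j < (1 - \<delta>) * (\<Sum>i\<in>UNIV. x $ i)})"
    unfolding O_set_eq by auto
  also have "open \<dots>"
    by (intro open_INT ballI open_Int open_Collect_less continuous_intros) auto
  finally show ?thesis .
qed

lemma O_set_pos: "x \<in> O_set \<delta> \<Longrightarrow> 0 < x $ i"
  by (simp add: O_set_def)

theorem theorem1:
  fixes M :: "'a measure" and F :: "real \<Rightarrow> 'a measure" and T \<delta> :: real
    and S :: "real \<Rightarrow> 'a \<Rightarrow> real ^ 'n::finite"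
  assumes "T > 0"
    and "usual_filtered_space M F T"
    and "0 < \<delta>" and "\<delta> < 1"
    and "cont_adapted_process M F T (O_set \<delta>) S"
    and "cond_full_support M F T (O_set \<delta>) S"
  shows "\<forall>\<epsilon>>0. \<exists>St Q. eps_cps M F T \<epsilon> S St Q \<and>
            (\<forall>t\<in>{0..T}. \<forall>\<omega>\<in>space M. St t \<omega> \<in> O_set \<delta>)"
  using assms by (intro allI impI ex_consistent_price_system_in_open open_O_set) (simp_all add: O_set_pos)

end
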